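(* Let $T$ be a tree on $n$ vertices with maximum degree $\Delta$. Then one can determine whether the semistrong chromatic index $\chi'_{ss}(T)$ equals $\Delta$ or $\Delta+1$ (equivalently, whether $T$ admits a semistrong edge coloring with $\Delta$ colors) in $O(\Delta^{6} n)$ time.
   Context: For a matching $M$ of a graph $G$, let $G_M$ denote the subgraph of $G$ induced by the vertices covered by $M$. A matching $M$ is semistrong if every edge of $M$ has at least one endvertex of degree $1$ in $G_M$. A semistrong edge coloring of $G$ is an edge coloring in which every color class is a semistrong matching; the semistrong chromatic index $\chi'_{ss}(G)$ is the minimum number of colors in such a coloring. It is known (from prior work) that every tree with maximum degree $\Delta$ has $\chi'_{ss}(T)\in\{\Delta,\Delta+1\}$. *)

theory Defs
  imports Main
begin

section \<open>Graphs and semistrong edge colorings\<close>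

text \<open>A finite simple graph is a vertex set together with a set of two-element sets.\<close>

definition simple_graph :: "'a set \<Rightarrow> 'a set set \<Rightarrow> bool" where
  "simple_graph V E \<longleftrightarrow> finite V \<and> E \<subseteq> {{u, v} | u v. u \<in> V \<and> v \<in> V \<and> u \<noteq> v}"

definition walk :: "'a set \<Rightarrow> 'a set set \<Rightarrow> 'a list \<Rightarrow> bool" where
  "walk V E p \<longleftrightarrow> p \<noteq> [] \<and> set p \<subseteq> V \<and> successively (\<lambda>u v. {u, v} \<in> E) p"

definition connected_graph :: "'a set \<Rightarrow> 'a set set \<Rightarrow> bool" where
  "connected_graph V E \<longleftrightarrow>
     V \<noteq> {} \<and> (\<forall>u\<in>V. \<forall>v\<in>V. \<exists>p. walk V E p \<and> hd p = u \<and> last p = v)"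

definition cycle :: "'a set \<Rightarrow> 'a set set \<Rightarrow> 'a list \<Rightarrow> bool" where
  "cycle V E p \<longleftrightarrow> walk V E p \<and> distinct p \<and> length p \<ge> 3 \<and> {last p, hd p} \<in> E"

definition tree :: "'a set \<Rightarrow> 'a set set \<Rightarrow> bool" where
  "tree V E \<longleftrightarrow> simple_graph V E \<and> connected_graph V E \<and> (\<nexists>p. cycle V E p)"

definition degree :: "'a set set \<Rightarrow> 'a \<Rightarrow> nat" where
  "degree E v = card {e \<in> E. v \<in> e}"

definition max_degree :: "'a set \<Rightarrow> 'a set set \<Rightarrow> nat" where
  "max_degree V E = Max (degree E ` V)"

definition induced_edges :: "'a set set \<Rightarrow> 'a set \<Rightarrow> 'a set set" where
  "induced_edges E U = {e \<in> E. e \<subseteq> U}"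

definition matching :: "'a set set \<Rightarrow> 'a set set \<Rightarrow> bool" where
  "matching E M \<longleftrightarrow> M \<subseteq> E \<and> (\<forall>e\<in>M. \<forall>f\<in>M. e \<noteq> f \<longrightarrow> e \<inter> f = {})"

definition semistrong_matching :: "'a set set \<Rightarrow> 'a set set \<Rightarrow> bool" where
  "semistrong_matching E M \<longleftrightarrow>
     matching E M \<and> (\<forall>e\<in>M. \<exists>v\<in>e. degree (induced_edges E (\<Union>M)) v = 1)"

definition semistrong_edge_coloring :: "'a set set \<Rightarrow> nat \<Rightarrow> ('a set \<Rightarrow> nat) \<Rightarrow> bool" where
  "semistrong_edge_coloring E k c \<longleftrightarrow>
     c ` E \<subseteq> {..<k} \<and> (\<forall>i<k. semistrong_matching E {e \<in> E. c e = i})"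

definition semistrong_chromatic_index :: "'a set set \<Rightarrow> nat" where
  "semistrong_chromatic_index E = (LEAST k. \<exists>c. semistrong_edge_coloring E k c)"


section \<open>Model of computation: a word RAM with structured control flow\<close>

text \<open>
  Programs are while-programs over finitely many scalar variables and finitely many
  one-dimensional arrays (random access memory) holding natural numbers. Subtraction is
  truncated. A program is charged one time unit per operation, counting every node of every
  expression it evaluates.
\<close>

type_synonym vname = string

datatype aexp =
    Const nat
  | Var vname
  | Arr vname aexp
  | Add aexp aexp
  | Sub aexp aexp
  | Mul aexp aexp

datatype bexp =
    Less aexp aexp
  | Equal aexp aexp
  | Neg bexp
  | Conj bexp bexp

datatype com =
    Skip
  | Assign vname aexp
  | Store vname aexp aexp
  | Seq com com
  | Cond bexp com com
  | While bexp com

record state =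
  scalar :: "vname \<Rightarrow> nat"
  array :: "vname \<Rightarrow> nat \<Rightarrow> nat"

primrec aval :: "state \<Rightarrow> aexp \<Rightarrow> nat" where
  "aval s (Const m) = m"
| "aval s (Var x) = scalar s x"
| "aval s (Arr a e) = array s a (aval s e)"
| "aval s (Add e f) = aval s e + aval s f"
| "aval s (Sub e f) = aval s e - aval s f"
| "aval s (Mul e f) = aval s e * aval s f"

primrec bval :: "state \<Rightarrow> bexp \<Rightarrow> bool" where
  "bval s (Less e f) = (aval s e < aval s f)"
| "bval s (Equal e f) = (aval s e = aval s f)"
| "bval s (Neg b) = (\<not> bval s b)"
| "bval s (Conj b d) = (bval s b \<and> bval s d)"

primrec acost :: "aexp \<Rightarrow> nat" where
  "acost (Const m) = 1"
| "acost (Var x) = 1"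
| "acost (Arr a e) = 1 + acost e"
| "acost (Add e f) = 1 + acost e + acost f"
| "acost (Sub e f) = 1 + acost e + acost f"
| "acost (Mul e f) = 1 + acost e + acost f"

primrec bcost :: "bexp \<Rightarrow> nat" where
  "bcost (Less e f) = 1 + acost e + acost f"
| "bcost (Equal e f) = 1 + acost e + acost f"
| "bcost (Neg b) = 1 + bcost b"
| "bcost (Conj b d) = 1 + bcost b + bcost d"

text \<open>
  \<open>exec W c s t s'\<close>: started in \<open>s\<close>, the program \<open>c\<close> halts after \<open>t\<close> time units in \<open>s'\<close>.
  The machine is stuck when a value or a write address exceeds the largest word \<open>W\<close>, so a
  halting run keeps only values at most \<open>W\<close> in memory. Intermediate values inside an
  expression are not checked; as the expressions of a program have constant size, they occupy
  only a constant number of words.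
\<close>

inductive exec :: "nat \<Rightarrow> com \<Rightarrow> state \<Rightarrow> nat \<Rightarrow> state \<Rightarrow> bool" for W :: nat where
  Skip: "exec W Skip s 1 s"
| Assign: "aval s e \<le> W \<Longrightarrow>
    exec W (Assign x e) s (1 + acost e) (s\<lparr>scalar := (scalar s)(x := aval s e)\<rparr>)"
| Store: "aval s i \<le> W \<Longrightarrow> aval s e \<le> W \<Longrightarrow>
    exec W (Store a i e) s (1 + acost i + acost e)
      (s\<lparr>array := (array s)(a := (array s a)(aval s i := aval s e))\<rparr>)"
| Seq: "exec W c s t s' \<Longrightarrow> exec W d s' t' s'' \<Longrightarrow> exec W (Seq c d) s (t + t') s''"
| CondTrue: "bval s b \<Longrightarrow> exec W c s t s' \<Longrightarrow> exec W (Cond b c d) s (1 + bcost b + t) s'"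
| CondFalse: "\<not> bval s b \<Longrightarrow> exec W d s t s' \<Longrightarrow> exec W (Cond b c d) s (1 + bcost b + t) s'"
| WhileFalse: "\<not> bval s b \<Longrightarrow> exec W (While b c) s (1 + bcost b) s"
| WhileTrue: "bval s b \<Longrightarrow> exec W c s t s' \<Longrightarrow> exec W (While b c) s' t' s'' \<Longrightarrow>
    exec W (While b c) s (1 + bcost b + t + t') s''"

inductive_cases exec_SkipE: "exec W Skip s t s'"
inductive_cases exec_AssignE: "exec W (Assign x e) s t s'"
inductive_cases exec_StoreE: "exec W (Store a i e) s t s'"
inductive_cases exec_SeqE: "exec W (Seq c d) s t s'"
inductive_cases exec_CondE: "exec W (Cond b c d) s t s'"
inductive_cases exec_WhileE: "exec W (While b c) s t s'"

lemma exec_deterministic: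
  "exec W c s t s' \<Longrightarrow> exec W c s u s'' \<Longrightarrow> u = t \<and> s'' = s'"
proof (induction arbitrary: u s'' rule: exec.induct)
  case (Skip s)
  then show ?case by (rule exec_SkipE) simp
next
  case (Assign s e x)
  from Assign.prems show ?case by (rule exec_AssignE) simp
next
  case (Store s i e a)
  from Store.prems show ?case by (rule exec_StoreE) simp
next
  case (Seq c s t s' d t' s2)
  from Seq.prems obtain t1 r t2
    where "u = t1 + t2" "exec W c s t1 r" "exec W d r t2 s''" by (rule exec_SeqE)
  with Seq.IH show ?case by metis
next
  case (CondTrue s b c t s' d)
  from CondTrue.prems obtain t1 where "u = 1 + bcost b + t1" "exec W c s t1 s''"
    by (rule exec_CondE) (use CondTrue.hyps in auto)
  with CondTrue.IH show ?case by metis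
next
  case (CondFalse s b d t s' c)
  from CondFalse.prems obtain t1 where "u = 1 + bcost b + t1" "exec W d s t1 s''"
    by (rule exec_CondE) (use CondFalse.hyps in auto)
  with CondFalse.IH show ?case by metis
next
  case (WhileFalse s b c)
  from WhileFalse.prems show ?case
    by (rule exec_WhileE) (use WhileFalse.hyps in auto)
next
  case (WhileTrue s b c t s' t' s2)
  from WhileTrue.prems obtain t1 r t2
    where "u = 1 + bcost b + t1 + t2" "exec W c s t1 r" "exec W (While b c) r t2 s''"
    by (rule exec_WhileE) (use WhileTrue.hyps in auto)
  with WhileTrue.IH show ?case by metis
qed


section \<open>Presentation of a graph to the machine\<close>

text \<open>
  A graph on the vertices \<open>0, \<dots>, n - 1\<close> is given as a list of its edges, each listed once, in an
  arbitrary order and with the end vertices in an arbitrary order. The list is stored in the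
  arrays \<open>u\<close> and \<open>v\<close>; the scalars \<open>n\<close> and \<open>m\<close> hold the numbers of vertices and of edges.
\<close>

definition edge_list :: "'a set set \<Rightarrow> ('a \<times> 'a) list \<Rightarrow> bool" where
  "edge_list E es \<longleftrightarrow>
     distinct (map (\<lambda>(u, v). {u, v}) es) \<and> set (map (\<lambda>(u, v). {u, v}) es) = E"

definition input_state :: "nat \<Rightarrow> (nat \<times> nat) list \<Rightarrow> state" where
  "input_state n es =
     \<lparr>scalar = (\<lambda>_. 0)(''n'' := n, ''m'' := length es),
      array = (\<lambda>_ _. 0)
        (''u'' := \<lambda>i. if i < length es then fst (es ! i) else 0,
         ''v'' := \<lambda>i. if i < length es then snd (es ! i) else 0)\<rparr>"

end

theory Submission
  imports Defs
begin

text \<open>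
  An edge \<open>e\<close> satisfies the semistrong condition at its end \<open>v\<close> (\<open>v\<close> is a private end of \<open>e\<close>) iff
  the color of \<open>e\<close> occurs at no other neighbour of \<open>v\<close>. Root the tree. By the symmetry of the
  colors, all that matters for a subtree hanging below \<open>v\<close> is whether \<open>v\<close> can be the private end of
  its parent edge and how many edges to children must have \<open>v\<close> as their private end. Making an
  additional child edge private at \<open>v\<close> relaxes the condition for that child by as much as it costs,
  so the greedy choice is optimal: a vertex is bad if it cannot be private for its parent edge, and
  exactly the edges to bad children are private at \<open>v\<close>. With \<open>f v\<close> bad children of \<open>v\<close>, a coloring
  with \<open>K \<ge> \<Delta>\<close> colors exists iff \<open>d y + f v \<le> K + [y bad]\<close> and \<open>f y + d v \<le> K\<close> for every child \<open>y\<close>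
  of every vertex \<open>v\<close>; for \<open>K = \<Delta> + 1\<close> no vertex is bad and the conditions always hold. Removing
  leaves one by one evaluates these conditions for \<open>K = \<Delta>\<close> in time linear in \<open>n\<close>.
\<close>

section \<open>Private ends of edges\<close>

definition palette :: "'a set set \<Rightarrow> ('a set \<Rightarrow> nat) \<Rightarrow> 'a \<Rightarrow> nat set" where
  "palette E c v = c ` {e \<in> E. v \<in> e}"

definition private_end :: "'a set set \<Rightarrow> ('a set \<Rightarrow> nat) \<Rightarrow> 'a set \<Rightarrow> 'a \<Rightarrow> bool" where
  "private_end E c e v \<longleftrightarrow> (\<forall>w. {v, w} \<in> E \<longrightarrow> {v, w} \<noteq> e \<longrightarrow> c e \<notin> palette E c w)"

lemma simple_graph_edgeE:
  assumes "simple_graph V E" "e \<in> E"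
  obtains u v where "e = {u, v}" "u \<noteq> v" "u \<in> V" "v \<in> V"
  using assms unfolding simple_graph_def by blast

lemma simple_graph_other_end:
  assumes "simple_graph V E" "e \<in> E" "v \<in> e"
  obtains w where "e = {v, w}" "v \<noteq> w"
  using simple_graph_edgeE[OF assms(1,2)] assms(3) by (metis insertE insert_commute singletonD)

lemma card_eq_1_iff_mem: "x \<in> X \<Longrightarrow> card X = 1 \<longleftrightarrow> X = {x}"
  by (auto simp: card_1_singleton_iff)

text \<open>The edge \<open>e\<close> itself lies in the induced subgraph, so degree 1 at
  \<open>v\<close> means that no other edge at \<open>v\<close> does. As \<open>e\<close> covers
  \<open>v\<close>, another edge at \<open>v\<close> lies in it exactly when its far end meets the
  color of \<open>e\<close>.\<close>

lemma degree_color_class_eq_1_iff: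
  assumes g: "simple_graph V E" and e: "e \<in> E" "v \<in> e"
  shows "degree (induced_edges E (\<Union>{e' \<in> E. c e' = c e})) v = 1 \<longleftrightarrow> private_end E c e v"
    (is "degree (induced_edges E ?U) v = 1 \<longleftrightarrow> _")
proof -
  let ?X = "{e' \<in> induced_edges E ?U. v \<in> e'}"
  have eX: "e \<in> ?X" using e by (auto simp: induced_edges_def)
  have "degree (induced_edges E ?U) v = 1 \<longleftrightarrow> ?X = {e}"
    unfolding degree_def using eX by (rule card_eq_1_iff_mem)
  also have "\<dots> \<longleftrightarrow> (\<forall>e'\<in>E. v \<in> e' \<longrightarrow> e' \<noteq> e \<longrightarrow> \<not> e' \<subseteq> ?U)"
    using eX by (auto simp: induced_edges_def)
  also have "\<dots> \<longleftrightarrow> private_end E c e v"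
  proof
    assume L: "\<forall>e'\<in>E. v \<in> e' \<longrightarrow> e' \<noteq> e \<longrightarrow> \<not> e' \<subseteq> ?U"
    have "v \<in> ?U" using e by blast
    then show "private_end E c e v"
      using L unfolding private_end_def palette_def by fastforce
  next
    assume R: "private_end E c e v"
    show "\<forall>e'\<in>E. v \<in> e' \<longrightarrow> e' \<noteq> e \<longrightarrow> \<not> e' \<subseteq> ?U"
    proof (intro ballI impI notI)
      fix e' assume e': "e' \<in> E" "v \<in> e'" "e' \<noteq> e" "e' \<subseteq> ?U"
      obtain w where w: "e' = {v, w}" using simple_graph_other_end[OF g e'(1,2)] .
      then obtain e'' where "e'' \<in> E" "c e'' = c e" "w \<in> e''" using e'(4) by auto
      then have "c e \<in> palette E c w" unfolding palette_def by (metis (mono_tags) imageI mem_Collect_eq)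
      then show False using R e' w unfolding private_end_def by blast
    qed
  qed
  finally show ?thesis .
qed

text \<open>Every edge lies only in the class of its own color, so the quantifier over classes turns
  into conditions on single edges.\<close>

lemma semistrong_edge_coloring_iff:
  assumes g: "simple_graph V E"
  shows "semistrong_edge_coloring E k c \<longleftrightarrow>
    c ` E \<subseteq> {..<k} \<and> (\<forall>e\<in>E. \<forall>f\<in>E. e \<noteq> f \<longrightarrow> c e = c f \<longrightarrow> e \<inter> f = {}) \<and>
    (\<forall>e\<in>E. \<exists>v\<in>e. private_end E c e v)" (is "?L \<longleftrightarrow> ?R")
proof -
  have key: "(\<exists>v\<in>e. degree (induced_edges E (\<Union>{e' \<in> E. c e' = c e})) v = 1)
      \<longleftrightarrow> (\<exists>v\<in>e. private_end E c e v)" if "e \<in> E" for e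
    using degree_color_class_eq_1_iff[OF g that] by blast
  have "semistrong_matching E {e \<in> E. c e = i} \<longleftrightarrow>
      (\<forall>e\<in>E. \<forall>f\<in>E. c e = i \<longrightarrow> c f = i \<longrightarrow> e \<noteq> f \<longrightarrow> e \<inter> f = {}) \<and>
      (\<forall>e\<in>E. c e = i \<longrightarrow> (\<exists>v\<in>e. private_end E c e v))" for i
  proof -
    have "(\<forall>e\<in>{e \<in> E. c e = i}. \<exists>v\<in>e. degree (induced_edges E (\<Union>{e \<in> E. c e = i})) v = 1) \<longleftrightarrow>
        (\<forall>e\<in>E. c e = i \<longrightarrow> (\<exists>v\<in>e. private_end E c e v))"
      using key by force
    moreover have "matching E {e \<in> E. c e = i} \<longleftrightarrow>
        (\<forall>e\<in>E. \<forall>f\<in>E. c e = i \<longrightarrow> c f = i \<longrightarrow> e \<noteq> f \<longrightarrow> e \<inter> f = {})"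
      unfolding matching_def by auto
    ultimately show ?thesis unfolding semistrong_matching_def by argo
  qed
  then have "?L \<longleftrightarrow> c ` E \<subseteq> {..<k} \<and>
      (\<forall>i<k. (\<forall>e\<in>E. \<forall>f\<in>E. c e = i \<longrightarrow> c f = i \<longrightarrow> e \<noteq> f \<longrightarrow> e \<inter> f = {}) \<and>
      (\<forall>e\<in>E. c e = i \<longrightarrow> (\<exists>v\<in>e. private_end E c e v)))"
    unfolding semistrong_edge_coloring_def by simp
  also have "\<dots> \<longleftrightarrow> ?R"
  proof (intro iffI; elim conjE)
    assume "c ` E \<subseteq> {..<k}" and "\<forall>i<k. (\<forall>e\<in>E. \<forall>f\<in>E. c e = i \<longrightarrow> c f = i \<longrightarrow> e \<noteq> f \<longrightarrow> e \<inter> f = {}) \<and>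
      (\<forall>e\<in>E. c e = i \<longrightarrow> (\<exists>v\<in>e. private_end E c e v))"
    then show ?R by (simp add: image_subset_iff) metis
  qed simp
  finally show ?thesis .
qed

lemma max_degree_le_if_semistrong:
  assumes g: "simple_graph V E" and c: "semistrong_edge_coloring E k c" and "V \<noteq> {}"
  shows "max_degree V E \<le> k"
proof -
  have fV: "finite V" using g by (simp add: simple_graph_def)
  have "degree E v \<le> k" for v
  proof -
    have "inj_on c {e \<in> E. v \<in> e}"
      using c unfolding semistrong_edge_coloring_iff[OF g] inj_on_def by blast
    moreover have "c ` {e \<in> E. v \<in> e} \<subseteq> {..<k}"
      using c unfolding semistrong_edge_coloring_iff[OF g] by blast
    ultimately show ?thesis unfolding degree_def using card_inj_on_le[of c _ "{..<k}"] by simp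
  qed
  then show ?thesis unfolding max_degree_def using fV \<open>V \<noteq> {}\<close> by simp
qed

section \<open>Semistrong colorings of rooted forests\<close>

text \<open>\<open>P\<close> holds the vertices with a parent, so each edge is named by its lower
  end. The strictly increasing \<open>rk\<close> excludes cycles; vertices outside \<open>P\<close>
  act as roots.\<close>

locale rooted_forest =
  fixes P :: "'a set" and par :: "'a \<Rightarrow> 'a" and rk :: "'a \<Rightarrow> nat" and E :: "'a set set"
  assumes finite_P: "finite P"
    and E_eq: "E = (\<lambda>y. {y, par y}) ` P"
    and rk_par: "y \<in> P \<Longrightarrow> rk y < rk (par y)"
begin

abbreviation edge :: "'a \<Rightarrow> 'a set" where "edge y \<equiv> {y, par y}"

definition children :: "'a \<Rightarrow> 'a set" where "children v = {y \<in> P. par y = v}"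

text \<open>Indexes the edges at \<open>v\<close> by their lower ends: \<open>v\<close> itself
  stands for its parent edge.\<close>

definition star :: "'a \<Rightarrow> 'a set" where "star v = children v \<union> ({v} \<inter> P)"

text \<open>Otherwise two vertices would be each other's parent, and the ranks would rise both
  ways.\<close>

lemma inj_edge: "inj_on edge P"
proof (rule inj_onI)
  fix x y assume "x \<in> P" "y \<in> P" "edge x = edge y"
  then show "x = y" using rk_par[of x] rk_par[of y] by (metis doubleton_eq_iff less_asym)
qed

lemma simple: "simple_graph (P \<union> par ` P) E"
proof -
  have "y \<noteq> par y" if "y \<in> P" for y using rk_par[OF that] by auto
  then show ?thesis unfolding simple_graph_def E_eq using finite_P by blast
qed

lemma finite_children [simp]: "finite (children v)"
  using finite_P by (simp add: children_def)

lemma finite_star [simp]: "finite (star v)"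
  by (simp add: star_def)

lemma star_subset: "star v \<subseteq> P"
  by (auto simp: star_def children_def)

lemma not_own_child: "v \<notin> children v"
  using rk_par[of v] by (auto simp: children_def)

lemma incident_eq: "{e \<in> E. v \<in> e} = edge ` star v"
  by (auto simp: E_eq star_def children_def)

lemma degree_eq_star: "degree E v = card (star v)"
  unfolding degree_def incident_eq
  using inj_on_subset[OF inj_edge star_subset] by (rule card_image)

lemma degree_eq: "degree E v = card (children v) + of_bool (v \<in> P)"
  unfolding degree_eq_star star_def using not_own_child by (simp add: card_insert_if)

lemma palette_eq: "palette E c v = (\<lambda>y. c (edge y)) ` star v"
  unfolding palette_def incident_eq by (simp add: image_image)

lemma neighbours: "{v, w} \<in> E \<longleftrightarrow> w \<in> children v \<or> v \<in> P \<and> w = par v"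
  by (auto simp: E_eq children_def doubleton_eq_iff)

text \<open>Apart from its parent, \<open>y\<close> has only its children as neighbours; the ranks
  keep a child from coinciding with \<open>par y\<close>.\<close>

lemma private_lower_end:
  assumes "y \<in> P"
  shows "private_end E c (edge y) y \<longleftrightarrow> (\<forall>z\<in>children y. c (edge y) \<notin> palette E c z)"
proof -
  have "z \<noteq> par y" if "z \<in> children y" for z
    using that rk_par[of z] rk_par[OF assms] by (auto simp: children_def)
  then show ?thesis unfolding private_end_def neighbours by (auto simp: doubleton_eq_iff)
qed

lemma private_upper_end:
  assumes "y \<in> P"
  shows "private_end E c (edge y) (par y) \<longleftrightarrow>
    (\<forall>z\<in>children (par y). z \<noteq> y \<longrightarrow> c (edge y) \<notin> palette E c z) \<and>
    (par y \<in> P \<longrightarrow> c (edge y) \<notin> palette E c (par (par y)))"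
proof -
  have "y \<noteq> par (par y)" if "par y \<in> P"
    using that rk_par[of "par y"] rk_par[OF assms] by auto
  then show ?thesis unfolding private_end_def neighbours by (auto simp: doubleton_eq_iff)
qed

section \<open>Necessary conditions for a coloring with \<open>K\<close> colors\<close>

context
  fixes K :: nat and c :: "'a set \<Rightarrow> nat"
  assumes coloring: "semistrong_edge_coloring E K c"
begin

lemma coloring_inj_star: "inj_on (\<lambda>y. c (edge y)) (star v)"
proof (rule inj_onI)
  fix x y assume xy: "x \<in> star v" "y \<in> star v" "c (edge x) = c (edge y)"
  have "v \<in> edge x" "v \<in> edge y" "edge x \<in> E" "edge y \<in> E"
    using xy star_subset by (auto simp: star_def children_def E_eq)
  then have "edge x = edge y"
    using coloring xy(3) unfolding semistrong_edge_coloring_iff[OF simple]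
    by (metis disjoint_iff)
  moreover have "x \<in> P" "y \<in> P" using xy star_subset by auto
  ultimately show "x = y" using inj_onD[OF inj_edge] by blast
qed

lemma color_less: "y \<in> P \<Longrightarrow> c (edge y) < K"
  using coloring unfolding semistrong_edge_coloring_def E_eq by auto

lemma coloring_private: "y \<in> P \<Longrightarrow> private_end E c (edge y) y \<or> private_end E c (edge y) (par y)"
  using coloring unfolding semistrong_edge_coloring_iff[OF simple] by (auto simp: E_eq)

text \<open>The palette of \<open>w\<close> and the colors of the edges in \<open>X\<close> are
  disjoint sets of sizes \<open>degree E w\<close> and \<open>card X\<close> among \<open>K\<close>
  colors.\<close>

lemma degree_plus_avoided_le:
  assumes X: "X \<subseteq> star u" and avoid: "\<And>z. z \<in> X \<Longrightarrow> c (edge z) \<notin> palette E c w"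
  shows "degree E w + card X \<le> K"
proof -
  let ?col = "\<lambda>y. c (edge y)"
  have fX: "finite X" using X by (rule finite_subset) simp
  have "card (palette E c w) = degree E w"
    unfolding palette_eq degree_eq_star by (rule card_image[OF coloring_inj_star])
  moreover have "card (?col ` X) = card X"
    by (rule card_image[OF inj_on_subset[OF coloring_inj_star X]])
  moreover have "card (palette E c w \<union> ?col ` X) = card (palette E c w) + card (?col ` X)"
  proof (rule card_Un_disjoint)
    show "palette E c w \<inter> ?col ` X = {}" using avoid by blast
  qed (use fX in \<open>simp_all add: palette_eq\<close>)
  moreover have "palette E c w \<union> ?col ` X \<subseteq> {..<K}"
    using color_less star_subset X unfolding palette_eq by fast
  then have "card (palette E c w \<union> ?col ` X) \<le> K" using card_mono[of "{..<K}"] by simp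
  ultimately show ?thesis by simp
qed

text \<open>If \<open>w\<close> belongs to \<open>X\<close>, its parent edge is seen at
  \<open>w\<close> and is left out of the count. This is the source of the slack of one granted to
  bad children.\<close>

lemma degree_child_plus_avoided_le:
  assumes X: "X \<subseteq> star u" and avoid: "\<And>z. z \<in> X \<Longrightarrow> z \<noteq> w \<Longrightarrow> c (edge z) \<notin> palette E c w"
  shows "degree E w + card X \<le> K + of_bool (w \<in> X)"
proof -
  have "finite X" using X by (rule finite_subset) simp
  moreover have "degree E w + card (X - {w}) \<le> K"
    by (rule degree_plus_avoided_le[of _ u]) (use assms in auto)
  ultimately show ?thesis by (auto simp: card_Diff_singleton_if split: if_splits)
qed

text \<open>A bad vertex cannot be the private end of its parent edge: some child would need more than
  \<open>K\<close> colors.\<close>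

context
  fixes Bad :: "'a set"
  assumes Bad_P: "Bad \<subseteq> P"
    and Bad_tight: "\<And>v. v \<in> Bad \<Longrightarrow> \<exists>y\<in>children v.
      K + of_bool (y \<in> Bad) < degree E y + card (children v \<inter> Bad) + 1"
begin

text \<open>Induction on the rank: the edges of the bad children of \<open>v\<close> are already
  known to be private at \<open>v\<close>. If the parent edge were private at \<open>v\<close> as
  well, the tight child \<open>y\<close> would have to avoid one color more than \<open>K\<close>
  allows.\<close>

lemma bad_not_private: "v \<in> Bad \<Longrightarrow> \<not> private_end E c (edge v) v"
proof (induction "rk v" arbitrary: v rule: less_induct)
  case less
  show ?case
  proof
    assume priv: "private_end E c (edge v) v"
    have vP: "v \<in> P" using less.prems Bad_P by auto
    obtain y where y: "y \<in> children v"
      "K + of_bool (y \<in> Bad) < degree E y + card (children v \<inter> Bad) + 1"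
      using Bad_tight[OF less.prems] by auto
    let ?X = "insert v (children v \<inter> Bad)"
    have "degree E y + card ?X \<le> K + of_bool (y \<in> ?X)"
    proof (rule degree_child_plus_avoided_le[of _ v])
      show "?X \<subseteq> star v" using vP by (auto simp: star_def)
    next
      fix z assume z: "z \<in> ?X" "z \<noteq> y"
      show "c (edge z) \<notin> palette E c y"
      proof (cases "z = v")
        case True
        then show ?thesis using priv y(1) private_lower_end[OF vP] by simp
      next
        case False
        then have zc: "z \<in> children v" "z \<in> Bad" using z by auto
        then have zP: "z \<in> P" "par z = v" by (auto simp: children_def)
        then have "\<not> private_end E c (edge z) z" using less.hyps[of z] rk_par zc by auto
        then have "private_end E c (edge z) (par z)" using coloring_private zP by blast
        then show ?thesis using private_upper_end[OF zP(1)] zP(2) y(1) z(2) by auto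
      qed
    qed
    moreover have "y \<noteq> v" using y(1) not_own_child by auto
    ultimately show False using y not_own_child[of v] by (auto simp: card_insert_if)
  qed
qed

lemma bad_private_upper:
  assumes "y \<in> Bad" shows "private_end E c (edge y) (par y)"
  using assms Bad_P bad_not_private[OF assms] coloring_private[of y] by auto

text \<open>Edges to bad children are private at \<open>v\<close>, so their colors are missing at
  every other child of \<open>v\<close>.\<close>

lemma necessary_down:
  assumes y: "y \<in> children v"
  shows "degree E y + card (children v \<inter> Bad) \<le> K + of_bool (y \<in> Bad)"
proof -
  have "degree E y + card (children v \<inter> Bad) \<le> K + of_bool (y \<in> children v \<inter> Bad)"
  proof (rule degree_child_plus_avoided_le[of _ v])
    show "children v \<inter> Bad \<subseteq> star v" by (auto simp: star_def)
  next
    fix z assume z: "z \<in> children v \<inter> Bad" "z \<noteq> y"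
    then have "z \<in> P" "par z = v" by (auto simp: children_def)
    then show "c (edge z) \<notin> palette E c y"
      using private_upper_end[of z] bad_private_upper[of z] z y by auto
  qed
  then show ?thesis using y by simp
qed

text \<open>Privacy at \<open>y\<close> also hides the colors of these edges from the parent of
  \<open>y\<close>.\<close>

lemma necessary_up:
  assumes y: "y \<in> P"
  shows "card (children y \<inter> Bad) + degree E (par y) \<le> K"
proof -
  have "degree E (par y) + card (children y \<inter> Bad) \<le> K"
  proof (rule degree_plus_avoided_le[of _ y])
    show "children y \<inter> Bad \<subseteq> star y" by (auto simp: star_def)
  next
    fix z assume z: "z \<in> children y \<inter> Bad"
    then have "z \<in> P" "par z = y" by (auto simp: children_def)
    then show "c (edge z) \<notin> palette E c (par y)"
      using private_upper_end[of z] bad_private_upper[of z] z y by auto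
  qed
  then show ?thesis by simp
qed

end

end

end

section \<open>Sufficiency: coloring from the roots down\<close>

text \<open>One step of the top-down construction at a vertex with palette \<open>B\<close>: \<open>Bc\<close> is the part of \<open>B\<close>
  left for the edges to the children \<open>Ch\<close>, \<open>F\<close> are the children whose edge must be private at the
  vertex (so it gets a color from \<open>R\<close>, which the parent does not see), and \<open>Q\<close> holds the color of
  the parent edge if that edge must be private at the vertex. Each child \<open>y\<close> receives a palette
  \<open>Cs y\<close> of size \<open>d y\<close> having \<open>f y\<close> colors outside \<open>B\<close>.\<close>

lemma distribute_colors:
  fixes K q :: nat
  assumes fin: "finite Ch" "finite B" and F: "F \<subseteq> Ch"
    and Bc: "Bc \<subseteq> B" "card Bc = card Ch"
    and R: "R \<subseteq> Bc" "card F \<le> card R"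
    and Q: "Q \<subseteq> B - Bc" and B: "B \<subseteq> {..<K}"
    and deg: "\<And>y. y \<in> Ch \<Longrightarrow> d y + card F + card Q \<le> K + of_bool (y \<in> F)"
    and up: "\<And>y. y \<in> Ch \<Longrightarrow> f y + card B \<le> K"
    and fd: "\<And>y. y \<in> Ch \<Longrightarrow> f y < d y"
  shows "\<exists>col Cs. inj_on col Ch \<and> col ` Ch = Bc \<and> col ` F \<subseteq> R \<and>
    (\<forall>y\<in>Ch. col y \<in> Cs y \<and> Cs y \<subseteq> {..<K} \<and> card (Cs y) = d y \<and> f y \<le> card (Cs y - B) \<and>
       (\<forall>z\<in>F. z \<noteq> y \<longrightarrow> col z \<notin> Cs y) \<and> Cs y \<inter> Q = {})"
proof -
  have finBc: "finite Bc" using Bc fin finite_subset by blast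
  have finF: "finite F" using F fin finite_subset by blast
  \<comment> \<open>Exactly \<open>card F\<close> colors hidden from the parent are reserved for the
    edges in \<open>F\<close>; the rest of \<open>Bc\<close> is dealt out arbitrarily.\<close>
  obtain R0 where R0: "R0 \<subseteq> R" "card R0 = card F" using R(2) by (meson obtain_subset_with_card_n)
  have finR0: "finite R0" using R0 R finBc by (meson finite_subset)
  obtain g where g: "bij_betw g F R0" using finite_same_card_bij[OF finF finR0] R0 by auto
  have "card (Ch - F) = card (Bc - R0)"
    using R0 R F Bc finF finR0 by (simp add: card_Diff_subset)
  then obtain h where h: "bij_betw h (Ch - F) (Bc - R0)"
    using finite_same_card_bij[of "Ch - F" "Bc - R0"] fin finBc by auto
  define col where "col y = (if y \<in> F then g y else h y)" for y
  have "bij_betw col F R0" using g by (simp add: col_def cong: bij_betw_cong)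
  moreover have "bij_betw col (Ch - F) (Bc - R0)" using h bij_betw_cong[of "Ch - F" col h] by (simp add: col_def)
  ultimately have "bij_betw col (F \<union> (Ch - F)) (R0 \<union> (Bc - R0))"
    by (rule bij_betw_combine) auto
  moreover have "F \<union> (Ch - F) = Ch" "R0 \<union> (Bc - R0) = Bc" using F R0 R by auto
  ultimately have bij: "bij_betw col Ch Bc" by simp
  have colF: "col ` F \<subseteq> R" using g R0 by (auto simp: col_def bij_betw_def)
  have ex: "\<exists>C. col y \<in> C \<and> C \<subseteq> {..<K} \<and> card C = d y \<and> f y \<le> card (C - B) \<and>
       (\<forall>z\<in>F. z \<noteq> y \<longrightarrow> col z \<notin> C) \<and> C \<inter> Q = {}" if y: "y \<in> Ch" for y
  proof -
    have cyBc: "col y \<in> Bc" using bij y by (auto simp: bij_betw_def)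
    have colFBc: "col ` F \<subseteq> Bc" using bij F by (auto simp: bij_betw_def)
    have injF: "inj_on col F" using bij F by (auto simp: bij_betw_def intro: inj_on_subset)
    \<comment> \<open>These are the colors whose status at \<open>y\<close> is settled:
      \<open>col y\<close> is present and all others in \<open>Z\<close> are forbidden.\<close>
    define Z where "Z = insert (col y) (col ` F \<union> Q)"
    have finQ: "finite Q" using Q fin finite_subset by blast
    have ZB: "Z \<subseteq> B" using cyBc colFBc Bc Q by (auto simp: Z_def)
    have mem: "col y \<in> col ` F \<longleftrightarrow> y \<in> F"
      using bij y F by (auto simp: bij_betw_def dest: inj_onD)
    have cQ: "col y \<notin> Q" "col ` F \<inter> Q = {}" using cyBc colFBc Q by auto
    have "card (col ` F \<union> Q) = card F + card Q"
      using cQ finF finQ by (simp add: card_Un_disjoint card_image[OF injF])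
    \<comment> \<open>For \<open>y\<close> in \<open>F\<close> the color \<open>col y\<close>
      already occurs among the colors of \<open>F\<close>, hence the correction by one.\<close>
    then have cZ: "card Z + of_bool (y \<in> F) = card F + card Q + 1"
      using mem cQ finF finQ by (auto simp: Z_def card_insert_if)
    define L where "L = {..<K} - Z"
    have finZ: "finite Z" using ZB fin finite_subset by blast
    have "card L = K - card Z" using finZ ZB B by (simp add: L_def card_Diff_subset)
    then have cL: "d y - 1 \<le> card L" using deg[OF y] cZ by simp
    have "card ({..<K} - B) = K - card B" using fin B by (simp add: card_Diff_subset)
    then have "f y \<le> card ({..<K} - B)" using up[OF y] by simp
    then obtain X0 where X0: "X0 \<subseteq> {..<K} - B" "card X0 = f y" by (meson obtain_subset_with_card_n)
    have X0L: "X0 \<subseteq> L" using X0 ZB by (auto simp: L_def)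
    have "f y \<le> d y - 1" using fd[OF y] by simp
    \<comment> \<open>\<open>X0\<close> supplies the \<open>f y\<close> colors outside
      \<open>B\<close>. It is filled up to \<open>d y - 1\<close> colors, the last place being kept
      for \<open>col y\<close>.\<close>
    then obtain X where X: "X0 \<subseteq> X" "X \<subseteq> L" "card X = d y - 1"
      using exists_subset_between[of X0 "d y - 1" L] X0 X0L cL by (auto simp: L_def)
    have finX: "finite X" using X(2) by (rule finite_subset) (simp add: L_def)
    have cX: "col y \<notin> X" using X by (auto simp: L_def Z_def)
    have "X0 \<subseteq> insert (col y) X - B" using X0 X by auto
    then have "f y \<le> card (insert (col y) X - B)" using X0(2) finX card_mono[of "insert (col y) X - B" X0] by simp
    moreover have "card (insert (col y) X) = d y" using cX finX X(3) fd[OF y] by simp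
    moreover have "insert (col y) X \<subseteq> {..<K}" using X cyBc Bc B by (auto simp: L_def)
    moreover have "\<forall>z\<in>F. z \<noteq> y \<longrightarrow> col z \<notin> insert (col y) X"
      using X bij F y by (auto simp: L_def Z_def bij_betw_def inj_on_def)
    moreover have "insert (col y) X \<inter> Q = {}" using X cQ by (auto simp: L_def Z_def)
    ultimately show ?thesis by blast
  qed
  then obtain Cs where "\<forall>y\<in>Ch. col y \<in> Cs y \<and> Cs y \<subseteq> {..<K} \<and> card (Cs y) = d y \<and>
      f y \<le> card (Cs y - B) \<and> (\<forall>z\<in>F. z \<noteq> y \<longrightarrow> col z \<notin> Cs y) \<and> Cs y \<inter> Q = {}"
    by metis
  then show ?thesis using bij colF by (auto simp: bij_betw_def)
qed

context rooted_forest
begin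

context
  fixes K :: nat and Bad :: "'a set"
  assumes Bad_P: "Bad \<subseteq> P"
    and down: "\<And>v y. y \<in> children v \<Longrightarrow>
      degree E y + card (children v \<inter> Bad) \<le> K + of_bool (y \<in> Bad)"
    and down_private: "\<And>v y. v \<in> P \<Longrightarrow> v \<notin> Bad \<Longrightarrow> y \<in> children v \<Longrightarrow>
      degree E y + card (children v \<inter> Bad) + 1 \<le> K + of_bool (y \<in> Bad)"
    and up: "\<And>y. y \<in> P \<Longrightarrow> card (children y \<inter> Bad) + degree E (par y) \<le> K"
begin

text \<open>Here \<open>a\<close> is the color of the edge from \<open>v\<close> to its parent, \<open>A\<close> and \<open>B\<close> are the palettes of
  the parent and of \<open>v\<close>, and \<open>col y\<close> and \<open>Cs y\<close> are the color of the edge from \<open>v\<close> to its child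
  \<open>y\<close> and the palette of \<open>y\<close>. At a root, \<open>a\<close> is meaningless and \<open>A\<close> is empty.\<close>

definition admissible :: "'a \<Rightarrow> nat \<Rightarrow> nat set \<Rightarrow> nat set \<Rightarrow> bool" where
  "admissible v a A B \<longleftrightarrow> B \<subseteq> {..<K} \<and> card B = degree E v \<and>
     card (children v \<inter> Bad) \<le> card (B - A) \<and> (v \<in> P \<longrightarrow> a \<in> A \<and> a \<in> B)"

definition extends :: "'a \<Rightarrow> nat \<Rightarrow> nat set \<Rightarrow> nat set \<Rightarrow> ('a \<Rightarrow> nat) \<Rightarrow> ('a \<Rightarrow> nat set) \<Rightarrow> bool" where
  "extends v a A B col Cs \<longleftrightarrow>
     inj_on col (children v) \<and> col ` children v = (if v \<in> P then B - {a} else B) \<and>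
     col ` (children v \<inter> Bad) \<subseteq> B - A \<and>
     (\<forall>y\<in>children v. col y \<in> Cs y \<and> Cs y \<subseteq> {..<K} \<and> card (Cs y) = degree E y \<and>
        card (children y \<inter> Bad) \<le> card (Cs y - B) \<and>
        (\<forall>z\<in>children v \<inter> Bad. z \<noteq> y \<longrightarrow> col z \<notin> Cs y) \<and>
        (v \<in> P \<and> v \<notin> Bad \<longrightarrow> a \<notin> Cs y))"

text \<open>An instance of \<open>distribute_colors\<close> in which the colors hidden from the
  parent are \<open>B - A\<close>. They exclude the color of the parent edge, which lies in
  \<open>A\<close>.\<close>

lemma extends_exists:
  assumes adm: "admissible v a A B"
  shows "\<exists>col Cs. extends v a A B col Cs"
proof -
  define Q where "Q = (if v \<in> P \<and> v \<notin> Bad then {a} else {})"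
  define Bc where "Bc = (if v \<in> P then B - {a} else B)"
  have finB: "finite B" using adm finite_subset unfolding admissible_def by blast
  have "\<exists>col Cs. inj_on col (children v) \<and> col ` children v = Bc \<and>
    col ` (children v \<inter> Bad) \<subseteq> B - A \<and>
    (\<forall>y\<in>children v. col y \<in> Cs y \<and> Cs y \<subseteq> {..<K} \<and> card (Cs y) = degree E y \<and>
       card (children y \<inter> Bad) \<le> card (Cs y - B) \<and>
       (\<forall>z\<in>children v \<inter> Bad. z \<noteq> y \<longrightarrow> col z \<notin> Cs y) \<and> Cs y \<inter> Q = {})"
  proof (rule distribute_colors)
    show "finite (children v)" "finite B" "children v \<inter> Bad \<subseteq> children v" "Bc \<subseteq> B"
      using finB by (auto simp: Bc_def)
    show "card Bc = card (children v)"
      using adm finB by (auto simp: Bc_def admissible_def degree_eq)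
    show "B - A \<subseteq> Bc" "card (children v \<inter> Bad) \<le> card (B - A)" "B \<subseteq> {..<K}"
      using adm by (auto simp: admissible_def Bc_def)
    show "Q \<subseteq> B - Bc" using adm by (auto simp: Q_def Bc_def admissible_def)
  next
    fix y assume y: "y \<in> children v"
    then have yP: "y \<in> P" "par y = v" by (auto simp: children_def)
    show "degree E y + card (children v \<inter> Bad) + card Q \<le> K + of_bool (y \<in> children v \<inter> Bad)"
      using down[OF y] down_private[of v, OF _ _ y] y by (simp add: Q_def)
    show "card (children y \<inter> Bad) + card B \<le> K"
      using up[OF yP(1)] adm by (simp add: yP(2) admissible_def)
    \<comment> \<open>The parent edge of \<open>y\<close> contributes to its degree but not to its
      children, which makes the bound below strict.\<close>
    have "card (children y \<inter> Bad) \<le> card (children y)" by (rule card_mono) auto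
    then show "card (children y \<inter> Bad) < degree E y" using yP(1) by (simp add: degree_eq)
  qed
  then show ?thesis unfolding extends_def Bc_def Q_def by (auto split: if_splits)
qed

lemma admissible_child:
  assumes "extends v a A B col Cs" "y \<in> children v"
  shows "admissible y (col y) B (Cs y)"
  using assms unfolding extends_def admissible_def by (auto split: if_splits)

text \<open>A root has no parent to hide colors from, so an initial segment of the colors will do.
  The bound by \<open>K\<close> comes from \<open>up\<close> at any child.\<close>

lemma admissible_root: "v \<notin> P \<Longrightarrow> admissible v a {} {..<degree E v}"
proof -
  assume v: "v \<notin> P"
  have "card (children v \<inter> Bad) \<le> card (children v)" by (rule card_mono) auto
  moreover have "degree E v \<le> K"
  proof (cases "children v = {}")
    case False
    then obtain y where "y \<in> P" "par y = v" by (auto simp: children_def)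
    then show ?thesis using up[of y] by auto
  qed (use v in \<open>simp add: degree_eq\<close>)
  ultimately show ?thesis using v by (auto simp: admissible_def degree_eq)
qed

text \<open>Recursion runs from the roots down, against the ranks; finiteness of \<open>P\<close>
  bounds the ranks of parents and so yields a measure.\<close>

lemma wf_parent: "wf {(par y, y) | y. y \<in> P}"
proof (rule wf_subset)
  let ?N = "Max (rk ` par ` P)"
  show "{(par y, y) | y. y \<in> P} \<subseteq> measure (\<lambda>v. ?N - rk v)"
  proof clarsimp
    fix y assume y: "y \<in> P"
    then have "rk (par y) \<le> ?N" using finite_P by simp
    then show "?N - rk (par y) < ?N - rk y" using rk_par[OF y] by linarith
  qed
qed simp

text \<open>The data at a vertex depend on those chosen at its parent, so they are picked by
  dependent choice along \<open>wf_parent\<close>.\<close>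

lemma extension_family:
  "\<exists>C A B col Cs. \<forall>v. admissible v (C v) (A v) (B v) \<and>
     extends v (C v) (A v) (B v) (col v) (Cs v) \<and>
     (v \<in> P \<longrightarrow> C v = col (par v) v \<and> A v = B (par v) \<and> B v = Cs (par v) v)"
proof -
  define ok :: "('a \<Rightarrow> nat \<times> nat set \<times> nat set \<times> ('a \<Rightarrow> nat) \<times> ('a \<Rightarrow> nat set)) \<Rightarrow> 'a \<Rightarrow>
      nat \<times> nat set \<times> nat set \<times> ('a \<Rightarrow> nat) \<times> ('a \<Rightarrow> nat set) \<Rightarrow> bool"
    where "ok f v r = (case r of (a, A, B, col, Cs) \<Rightarrow>
      admissible v a A B \<and> extends v a A B col Cs \<and>
      (v \<in> P \<longrightarrow> (case f (par v) of (a', A', B', col', Cs') \<Rightarrow>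
         a = col' v \<and> A = B' \<and> B = Cs' v)))" for f v r
  have "\<exists>f. \<forall>v. ok f v (f v)"
  proof (rule dependent_wf_choice[OF wf_parent])
    fix f g :: "'a \<Rightarrow> nat \<times> nat set \<times> nat set \<times> ('a \<Rightarrow> nat) \<times> ('a \<Rightarrow> nat set)" and x r
    assume "\<And>z. (z, x) \<in> {(par y, y) | y. y \<in> P} \<Longrightarrow> f z = g z"
    then have "x \<in> P \<Longrightarrow> f (par x) = g (par x)" by blast
    then show "ok f x r = ok g x r" unfolding ok_def by (auto split: prod.splits)
  next
    fix x f
    assume IH: "\<And>y. (y, x) \<in> {(par y, y) | y. y \<in> P} \<Longrightarrow> ok f y (f y)"
    show "\<exists>r. ok f x r"
    proof (cases "x \<in> P")
      case True
      then have "ok f (par x) (f (par x))" using IH by blast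
      moreover obtain a' A' B' col' Cs' where f: "f (par x) = (a', A', B', col', Cs')"
        by (metis prod_cases5)
      ultimately have "extends (par x) a' A' B' col' Cs'" by (auto simp: ok_def)
      then have adm: "admissible x (col' x) B' (Cs' x)"
        using True by (intro admissible_child) (auto simp: children_def)
      then obtain col Cs where "extends x (col' x) B' (Cs' x) col Cs" using extends_exists by blast
      then have "ok f x (col' x, B', Cs' x, col, Cs)" using adm f by (simp add: ok_def)
      then show ?thesis by blast
    next
      case False
      note adm = admissible_root[OF False, of 0]
      then obtain col Cs where "extends x 0 {} {..<degree E x} col Cs" using extends_exists by blast
      then have "ok f x (0, {}, {..<degree E x}, col, Cs)" using adm False by (simp add: ok_def)
      then show ?thesis by blast
    qed
  qed
  then obtain f where f: "\<forall>v. ok f v (f v)" by blast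
  show ?thesis
  proof (intro exI allI)
    fix v
    show "admissible v (fst (f v)) (fst (snd (f v))) (fst (snd (snd (f v)))) \<and>
     extends v (fst (f v)) (fst (snd (f v))) (fst (snd (snd (f v))))
       (fst (snd (snd (snd (f v))))) (snd (snd (snd (snd (f v))))) \<and>
     (v \<in> P \<longrightarrow> fst (f v) = fst (snd (snd (snd (f (par v))))) v \<and>
        fst (snd (f v)) = fst (snd (snd (f (par v)))) \<and>
        fst (snd (snd (f v))) = snd (snd (snd (snd (f (par v))))) v)"
      using f[rule_format, of v] by (auto simp: ok_def split_beta)
  qed
qed

text \<open>Each edge takes the color planned for its lower end. The palettes that arise are the
  planned sets \<open>B v\<close>, after which privacy can be read off
  \<open>extends\<close>.\<close>

lemma sufficient: "\<exists>c. semistrong_edge_coloring E K c"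
proof -
  obtain C A B col Cs where adm: "\<And>v. admissible v (C v) (A v) (B v)"
    and ext: "\<And>v. extends v (C v) (A v) (B v) (col v) (Cs v)"
    and link: "\<And>v. v \<in> P \<Longrightarrow> C v = col (par v) v \<and> A v = B (par v) \<and> B v = Cs (par v) v"
    using extension_family by metis
  have Ccol: "C y = col v y" "B y = Cs v y" "A y = B v" if "y \<in> children v" for y v
    using link[of y] that by (auto simp: children_def)
  have img: "C ` children v = col v ` children v" for v using Ccol by auto
  define c where "c e = C (inv_into P edge e)" for e
  have c_edge: "c (edge y) = C y" if "y \<in> P" for y
    unfolding c_def using inv_into_f_f[OF inj_edge that] by simp
  have pal: "palette E c v = B v" for v
  proof -
    have "palette E c v = C ` star v"
      unfolding palette_eq using c_edge star_subset[of v] by (intro image_cong) auto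
    also have "\<dots> = B v"
      using ext[of v] adm[of v] unfolding star_def image_Un img extends_def admissible_def
      by (cases "v \<in> P") auto
    finally show ?thesis .
  qed
  \<comment> \<open>The colors at \<open>v\<close> fill a palette whose size is the degree of
    \<open>v\<close>, so no two of them coincide.\<close>
  have inj_star: "inj_on C (star v)" for v
  proof (rule eq_card_imp_inj_on)
    have "C ` star v = palette E c v"
      unfolding palette_eq using c_edge star_subset[of v] by (intro image_cong) auto
    then show "card (C ` star v) = card (star v)"
      using adm[of v] by (simp add: pal admissible_def degree_eq_star)
  qed simp
  have "semistrong_edge_coloring E K c"
    unfolding semistrong_edge_coloring_iff[OF simple]
  proof (intro conjI ballI impI)
    show "c ` E \<subseteq> {..<K}"
    proof
      fix i assume "i \<in> c ` E"
      then obtain y where "y \<in> P" "i = C y" using c_edge by (auto simp: E_eq)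
      then show "i \<in> {..<K}" using adm[of y] by (auto simp: admissible_def)
    qed
  next
    fix e f assume ef: "e \<in> E" "f \<in> E" "e \<noteq> f" "c e = c f"
    then obtain x y where xy: "x \<in> P" "y \<in> P" "e = edge x" "f = edge y" by (auto simp: E_eq)
    then have C: "C x = C y" "x \<noteq> y" using c_edge ef by auto
    show "e \<inter> f = {}"
    proof (rule ccontr)
      assume "e \<inter> f \<noteq> {}"
      then obtain v where "v \<in> e" "v \<in> f" by blast
      then have "x \<in> star v" "y \<in> star v" using xy by (auto simp: star_def children_def)
      then show False using inj_star[of v] C by (auto dest: inj_onD)
    qed
  next
    fix e assume "e \<in> E"
    then obtain y where y: "y \<in> P" "e = edge y" by (auto simp: E_eq)
    show "\<exists>v\<in>e. private_end E c e v"
    proof (cases "y \<in> Bad")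
      case False
      have "private_end E c (edge y) y"
        unfolding private_lower_end[OF y(1)] pal c_edge[OF y(1)]
        using ext[of y] False y(1) Ccol by (auto simp: extends_def)
      then show ?thesis using y by auto
    next
      case True
      let ?v = "par y"
      have yc: "y \<in> children ?v" using y by (auto simp: children_def)
      have "C y \<notin> B z" if "z \<in> children ?v" "z \<noteq> y" for z
        using ext[of ?v] that yc True Ccol by (auto simp: extends_def)
      \<comment> \<open>Edges of bad children take their colors from \<open>B - A\<close>, so the
        grandparent does not see them.\<close>
      moreover have "C y \<notin> A ?v"
        using ext[of ?v] yc True Ccol(1)[OF yc] by (auto simp: extends_def)
      ultimately have "private_end E c (edge y) ?v"
        unfolding private_upper_end[OF y(1)] pal c_edge[OF y(1)] using link[of ?v] by auto
      then show ?thesis using y by auto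
    qed
  qed
  then show ?thesis by blast
qed

end

end

section \<open>Peeling leaves\<close>

definition nbrs :: "'a set set \<Rightarrow> 'a \<Rightarrow> 'a set" where
  "nbrs E v = {w. {v, w} \<in> E}"

lemma nbrs_subset: "simple_graph V E \<Longrightarrow> nbrs E v \<subseteq> V - {v}"
  unfolding nbrs_def simple_graph_def by (auto simp: doubleton_eq_iff)

lemma finite_nbrs: "simple_graph V E \<Longrightarrow> finite (nbrs E v)"
  by (meson finite_Diff finite_subset nbrs_subset simple_graph_def)

lemma simple_graph_mono: "simple_graph V E \<Longrightarrow> F \<subseteq> E \<Longrightarrow> simple_graph V F"
  unfolding simple_graph_def by blast

lemma degree_eq_card_nbrs:
  assumes "simple_graph V E"
  shows "degree E v = card (nbrs E v)"
proof -
  have "{e \<in> E. v \<in> e} = (\<lambda>w. {v, w}) ` nbrs E v"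
  proof
    show "{e \<in> E. v \<in> e} \<subseteq> (\<lambda>w. {v, w}) ` nbrs E v"
    proof
      fix e assume "e \<in> {e \<in> E. v \<in> e}"
      then obtain w where "e = {v, w}" "e \<in> E" using simple_graph_other_end[OF assms] by blast
      then show "e \<in> (\<lambda>w. {v, w}) ` nbrs E v" by (simp add: nbrs_def)
    qed
  qed (auto simp: nbrs_def)
  moreover have "inj_on (\<lambda>w. {v, w}) (nbrs E v)"
    by (auto simp: inj_on_def doubleton_eq_iff)
  ultimately show ?thesis unfolding degree_def by (simp add: card_image)
qed

text \<open>The first vertex of a longest path in \<open>F\<close> has a neighbour besides the
  second one. By maximality it lies on the path, and it closes a cycle. Isolated vertices are
  harmless, as only degree 1 is excluded.\<close>

lemma cycle_if_no_leaf:
  assumes g: "simple_graph V E" and F: "F \<subseteq> E" "F \<noteq> {}"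
    and no_leaf: "\<And>v. v \<in> V \<Longrightarrow> card (nbrs F v) \<noteq> 1"
  shows "\<exists>p. cycle V E p"
proof -
  have gF: "simple_graph V F" using simple_graph_mono[OF g F(1)] .
  have finV: "finite V" using g by (simp add: simple_graph_def)
  define path where "path p \<longleftrightarrow> walk V F p \<and> distinct p \<and> length p \<ge> 2" for p
  obtain e where "e \<in> F" using F(2) by blast
  then obtain u v where uv: "e = {u, v}" "u \<noteq> v" "u \<in> V" "v \<in> V"
    using simple_graph_edgeE[OF gF] by metis
  then have "path [u, v]" using \<open>e \<in> F\<close> by (auto simp: path_def walk_def)
  moreover have "\<forall>p. path p \<longrightarrow> length p < Suc (card V)"
  proof (intro allI impI)
    fix p assume "path p"
    then have "length p = card (set p)" "set p \<subseteq> V"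
      by (auto simp: path_def walk_def distinct_card)
    then show "length p < Suc (card V)" using card_mono[OF finV, of "set p"] by simp
  qed
  ultimately obtain p where p: "path p" and max: "\<And>q. path q \<Longrightarrow> length q \<le> length p"
    using ex_has_greatest_nat[of path _ length] by metis
  obtain a b ps where p_eq: "p = a # b # ps"
    using p unfolding path_def by (metis Suc_le_length_iff numeral_2_eq_2)
  have ab: "{a, b} \<in> F" "a \<in> V" "distinct p" "set p \<subseteq> V" "walk V F p"
    using p by (auto simp: path_def walk_def p_eq)
  have "b \<in> nbrs F a" using ab by (simp add: nbrs_def)
  moreover have "nbrs F a \<noteq> {b}" using no_leaf[OF ab(2)] by auto
  ultimately obtain w where w: "{a, w} \<in> F" "w \<noteq> b" by (auto simp: nbrs_def)
  have wV: "w \<in> V" "w \<noteq> a" using nbrs_subset[OF gF, of a] w(1) by (auto simp: nbrs_def)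
  have "w \<in> set p"
  proof (rule ccontr)
    assume "w \<notin> set p"
    moreover have "{w, a} \<in> F" using w(1) by (simp add: insert_commute)
    ultimately have "path (w # p)" using p wV by (auto simp: path_def walk_def p_eq)
    then show False using max[of "w # p"] by simp
  qed
  then have "w \<in> set ps" using w wV by (auto simp: p_eq)
  then obtain xs ys where ps: "ps = xs @ w # ys" by (meson split_list)
  let ?q = "a # b # xs @ [w]"
  have "p = ?q @ ys" by (simp add: p_eq ps)
  then have "successively (\<lambda>u v. {u, v} \<in> F) ?q" "distinct ?q" "set ?q \<subseteq> V"
    using ab unfolding walk_def by (metis successively_append_iff, metis distinct_append, auto)
  then have "walk V E ?q" "distinct ?q"
    using F(1) unfolding walk_def by (auto elim: successively_mono)
  moreover have "{last ?q, hd ?q} \<in> E" using w F by (auto simp: insert_commute)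
  ultimately have "cycle V E ?q" by (simp add: cycle_def)
  then show ?thesis by blast
qed

text \<open>\<open>P\<close> are the vertices removed so far as leaves, and \<open>F\<close> are the remaining edges. A removed vertex
  is bad iff \<open>\<not> M y + f y < D\<close>; \<open>f\<close> counts bad children and \<open>M\<close> is the maximum of the degrees of the
  children, reduced by one for bad children. As \<open>s\<close> sums the remaining neighbours, it yields the
  parent of a leaf without adjacency lists. The bounds on \<open>M\<close> are stated as an equivalence so that
  no maximum of an empty set occurs.\<close>

definition peeled :: "nat \<Rightarrow> nat set set \<Rightarrow> nat \<Rightarrow> nat set \<Rightarrow> (nat \<Rightarrow> nat) \<Rightarrow> (nat \<Rightarrow> nat) \<Rightarrow>
    nat set set \<Rightarrow> (nat \<Rightarrow> nat) \<Rightarrow> (nat \<Rightarrow> nat) \<Rightarrow> (nat \<Rightarrow> nat) \<Rightarrow> (nat \<Rightarrow> nat) \<Rightarrow> (nat \<Rightarrow> nat) \<Rightarrow> bool" where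
  "peeled n E D P par rk F r s f M g \<longleftrightarrow>
     P \<subseteq> {..<n} \<and> E = F \<union> (\<lambda>y. {y, par y}) ` P \<and> (\<forall>e\<in>F. e \<inter> P = {}) \<and>
     (\<forall>y\<in>P. rk y < card P \<and> rk y < rk (par y)) \<and> (\<forall>z. z \<notin> P \<longrightarrow> rk z = n) \<and>
     (\<forall>z. r z = card (nbrs F z)) \<and> (\<forall>z. z \<notin> P \<longrightarrow> s z = \<Sum>(nbrs F z)) \<and>
     (\<forall>z. f z = card {y \<in> P. par y = z \<and> \<not> M y + f y < D}) \<and>
     (\<forall>z b. M z \<le> b \<longleftrightarrow>
        (\<forall>y\<in>P. par y = z \<longrightarrow> degree E y - of_bool (\<not> M y + f y < D) \<le> b)) \<and>
     (\<forall>z. g z = (if z \<in> P then degree E (par z) else 0))"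

lemma peeled_initial:
  "peeled n E D {} par (\<lambda>_. n) E (\<lambda>z. card (nbrs E z)) (\<lambda>z. \<Sum>(nbrs E z)) (\<lambda>_. 0) (\<lambda>_. 0) (\<lambda>_. 0)"
  by (simp add: peeled_def)

context
  fixes n D P par rk E F r s f M g x p
  assumes graph: "simple_graph {..<n} E"
    and inv: "peeled n E D P par rk F r s f M g"
    and leaf: "r x = 1" and p_def: "p = s x"
begin

lemma leaf_facts:
  shows "x \<notin> P" "nbrs F x = {p}" "{x, p} \<in> F" "p \<notin> P" "p \<noteq> x" "x < n" "p < n" "card P < n"
    "x \<in> nbrs F p"
proof -
  have FE: "F \<subseteq> E" and PF: "\<forall>e\<in>F. e \<inter> P = {}" and Pn: "P \<subseteq> {..<n}"
    and rx: "r x = card (nbrs F x)" and sx: "x \<notin> P \<Longrightarrow> s x = \<Sum>(nbrs F x)"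
    using inv unfolding peeled_def by blast+
  obtain q where q: "nbrs F x = {q}" using rx leaf by (metis card_1_singletonE)
  then have qF: "{x, q} \<in> F" by (auto simp: nbrs_def)
  then show xP: "x \<notin> P" using bspec[OF PF qF] by simp
  then have "p = q" using sx q p_def by simp
  then show "nbrs F x = {p}" and pF: "{x, p} \<in> F" using q qF by auto
  show "p \<notin> P" using bspec[OF PF pF] by simp
  have gF: "simple_graph {..<n} F" using simple_graph_mono[OF graph FE] .
  have pn: "p < n" "p \<noteq> x" using nbrs_subset[OF gF, of x] \<open>nbrs F x = {p}\<close> by auto
  then show "p < n" "p \<noteq> x" by auto
  show xp: "x \<in> nbrs F p" using pF by (simp add: nbrs_def insert_commute)
  then show "x < n" using nbrs_subset[OF gF, of p] by auto
  then have "P \<subset> {..<n}" using Pn xP by auto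
  then show "card P < n" using psubset_card_mono[of "{..<n}" P] by simp
qed

text \<open>\<open>x\<close> becomes a child of its only remaining neighbour \<open>p\<close>. Its
  rank is the time of its removal, while unremoved vertices stay at rank \<open>n\<close>, above all
  removed ones.\<close>

lemma peeled_step:
  "peeled n E D (insert x P) (par(x := p)) (rk(x := card P)) (F - {{x, p}})
     (r(x := 0, p := r p - 1)) (s(p := s p - x))
     (f(p := f p + of_bool (\<not> M x + f x < D)))
     (M(p := max (M p) (degree E x - of_bool (\<not> M x + f x < D))))
     (g(x := degree E p))"
proof -
  note lf = leaf_facts
  have Pn: "P \<subseteq> {..<n}" and E: "E = F \<union> (\<lambda>y. {y, par y}) ` P" and PF: "\<forall>e\<in>F. e \<inter> P = {}"
    and rk: "\<forall>y\<in>P. rk y < card P \<and> rk y < rk (par y)" and rkn: "\<forall>z. z \<notin> P \<longrightarrow> rk z = n"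
    and r: "\<forall>z. r z = card (nbrs F z)" and s: "\<forall>z. z \<notin> P \<longrightarrow> s z = \<Sum>(nbrs F z)"
    and f: "\<forall>z. f z = card {y \<in> P. par y = z \<and> \<not> M y + f y < D}"
    and M: "\<And>z b. M z \<le> b \<longleftrightarrow>
        (\<forall>y\<in>P. par y = z \<longrightarrow> degree E y - of_bool (\<not> M y + f y < D) \<le> b)"
    and g: "\<forall>z. g z = (if z \<in> P then degree E (par z) else 0)"
    using inv unfolding peeled_def by blast+
  let ?F = "F - {{x, p}}" and ?P = "insert x P" and ?par = "par(x := p)"
  let ?f = "f(p := f p + of_bool (\<not> M x + f x < D))"
  let ?M = "M(p := max (M p) (degree E x - of_bool (\<not> M x + f x < D)))"
  have finP: "finite P" using Pn finite_subset by blast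
  have gF: "simple_graph {..<n} F" using simple_graph_mono[OF graph] E by blast
  have finnb: "finite (nbrs F z)" for z using finite_nbrs[OF gF] .
  have nb: "nbrs ?F z = (if z = x then {} else if z = p then nbrs F p - {x} else nbrs F z)" for z
    using lf(2) by (auto simp: nbrs_def doubleton_eq_iff)
  \<comment> \<open>Neither \<open>x\<close> nor a vertex removed earlier is \<open>p\<close>, so
    their entries in \<open>M\<close> and \<open>f\<close> stay fixed and their badness is
    final.\<close>
  have same: "?M y + ?f y < D \<longleftrightarrow> M y + f y < D" if "y \<in> ?P" for y
    using that lf by auto
  have E': "E = ?F \<union> (\<lambda>y. {y, ?par y}) ` ?P"
  proof -
    have "(\<lambda>y. {y, ?par y}) ` ?P = insert {x, p} ((\<lambda>y. {y, par y}) ` P)"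
      using lf(1) by auto
    then show ?thesis using E lf(3) by auto
  qed
  have PF': "\<forall>e\<in>?F. e \<inter> ?P = {}"
  proof
    fix e assume e: "e \<in> ?F"
    have "x \<notin> e"
    proof
      assume "x \<in> e"
      then obtain w where w: "e = {x, w}" using simple_graph_other_end[OF gF] e by (metis DiffD1)
      then have "w \<in> nbrs F x" using e by (auto simp: nbrs_def)
      then show False using lf(2) w e by auto
    qed
    then show "e \<inter> ?P = {}" using PF e by auto
  qed
  \<comment> \<open>For children of \<open>x\<close> the rank of the parent falls from
    \<open>n\<close> to \<open>card P\<close>, which is still above theirs.\<close>
  have rk': "\<forall>y\<in>?P. (rk(x := card P)) y < card ?P \<and> (rk(x := card P)) y < (rk(x := card P)) (?par y)"
    using rk rkn lf finP by (auto simp: less_Suc_eq)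
  have r': "\<forall>z. (r(x := 0, p := r p - 1)) z = card (nbrs ?F z)"
    using r lf finnb by (auto simp: nb)
  have s': "\<forall>z. z \<notin> ?P \<longrightarrow> (s(p := s p - x)) z = \<Sum>(nbrs ?F z)"
    using s lf finnb by (auto simp: nb sum_diff1_nat)
  have f': "?f z = card {y \<in> ?P. ?par y = z \<and> \<not> ?M y + ?f y < D}" for z
  proof -
    have "{y \<in> ?P. ?par y = z \<and> \<not> ?M y + ?f y < D} = {y \<in> ?P. ?par y = z \<and> \<not> M y + f y < D}"
      using same by blast
    also have "\<dots> = {y \<in> P. par y = z \<and> \<not> M y + f y < D} \<union>
        (if z = p \<and> \<not> M x + f x < D then {x} else {})"
      using lf(1) by auto
    also have "card \<dots> = card {y \<in> P. par y = z \<and> \<not> M y + f y < D} +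
        of_bool (z = p \<and> \<not> M x + f x < D)"
      using lf(1) finP by auto
    also have "card {y \<in> P. par y = z \<and> \<not> M y + f y < D} = f z"
      by (rule f[rule_format, symmetric])
    also have "f z + of_bool (z = p \<and> \<not> M x + f x < D) = ?f z" by auto
    finally show ?thesis by simp
  qed
  have step: "(\<forall>y\<in>?P. ?par y = z \<longrightarrow> Q y) \<longleftrightarrow> (z = p \<longrightarrow> Q x) \<and> (\<forall>y\<in>P. par y = z \<longrightarrow> Q y)"
    for Q z using lf(1) by auto
  have M': "?M z \<le> b \<longleftrightarrow>
      (\<forall>y\<in>?P. ?par y = z \<longrightarrow> degree E y - of_bool (\<not> ?M y + ?f y < D) \<le> b)" for z b
  proof -
    have "(\<forall>y\<in>?P. ?par y = z \<longrightarrow> degree E y - of_bool (\<not> ?M y + ?f y < D) \<le> b) \<longleftrightarrow>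
        (\<forall>y\<in>?P. ?par y = z \<longrightarrow> degree E y - of_bool (\<not> M y + f y < D) \<le> b)"
      using same by simp
    also have "\<dots> \<longleftrightarrow> (z = p \<longrightarrow> degree E x - of_bool (\<not> M x + f x < D) \<le> b) \<and>
        (\<forall>y\<in>P. par y = z \<longrightarrow> degree E y - of_bool (\<not> M y + f y < D) \<le> b)"
      by (rule step)
    also have "\<dots> \<longleftrightarrow> (z = p \<longrightarrow> degree E x - of_bool (\<not> M x + f x < D) \<le> b) \<and> M z \<le> b"
      by (rule conj_cong[OF refl M[of z b, symmetric]])
    also have "\<dots> \<longleftrightarrow> ?M z \<le> b" by auto
    finally show ?thesis by simp
  qed
  have g': "\<forall>z. (g(x := degree E p)) z = (if z \<in> ?P then degree E (?par z) else 0)"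
    using g by simp
  have Pn': "?P \<subseteq> {..<n}" using Pn lf by auto
  have rkn': "\<forall>z. z \<notin> ?P \<longrightarrow> (rk(x := card P)) z = n" using rkn by auto
  show ?thesis
    unfolding peeled_def
    by (intro conjI; (fact Pn' E' PF' rk' rkn' r' s' g' | (intro allI, fact f' M')))
qed

end

text \<open>Edges remaining without any leaf would force a cycle.\<close>

lemma peeled_complete:
  assumes graph: "simple_graph {..<n} E" and acyclic: "\<nexists>p. cycle {..<n} E p"
    and inv: "peeled n E D P par rk F r s f M g" and no_leaf: "\<forall>j<n. r j \<noteq> 1"
  shows "F = {}"
proof (rule ccontr)
  assume "F \<noteq> {}"
  moreover have "F \<subseteq> E" "\<forall>z. r z = card (nbrs F z)" using inv unfolding peeled_def by blast+
  ultimately have "\<exists>p. cycle {..<n} E p"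
    using cycle_if_no_leaf[OF graph, of F] no_leaf by auto
  then show False using acyclic by blast
qed

text \<open>Once no edge remains, the record is a rooted forest, and \<open>M\<close> and
  \<open>g\<close> turn the downward and upward conditions into two inequalities per vertex. Badness
  is exactly the failure of the condition in \<open>Mf\<close>, which serves as tightness for
  necessity and as \<open>down_private\<close> for sufficiency.\<close>

lemma peeled_correct:
  assumes graph: "simple_graph {..<n} E"
    and inv: "peeled n E D P par rk {} r s f M g" and D: "\<And>v. degree E v \<le> D"
  shows "(\<exists>c. semistrong_edge_coloring E D c) \<longleftrightarrow> (\<forall>j<n. M j + f j \<le> D \<and> g j + f j \<le> D)"
    and "\<exists>c. semistrong_edge_coloring E (D + 1) c"
    and "card E \<le> n"
proof -
  have Pn: "P \<subseteq> {..<n}" and E: "E = (\<lambda>y. {y, par y}) ` P"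
    and rk: "\<forall>y\<in>P. rk y < rk (par y)" 
    and f: "\<forall>z. f z = card {y \<in> P. par y = z \<and> \<not> M y + f y < D}"
    and M: "\<And>z b. M z \<le> b \<longleftrightarrow>
        (\<forall>y\<in>P. par y = z \<longrightarrow> degree E y - of_bool (\<not> M y + f y < D) \<le> b)"
    and g: "\<forall>z. g z = (if z \<in> P then degree E (par z) else 0)"
    using inv unfolding peeled_def Un_empty_left by blast+
  have finP: "finite P" using Pn finite_subset by blast
  interpret rooted_forest P par rk E
    by unfold_locales (rule finP, rule E, use rk in blast)
  have "card E \<le> card P" unfolding E by (rule card_image_le[OF finP])
  also have "\<dots> \<le> n" using card_mono[OF _ Pn] by simp
  finally show "card E \<le> n" .
  \<comment> \<open>With one spare color no vertex has to be declared bad: every condition follows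
    from the degree bound.\<close>
  show "\<exists>c. semistrong_edge_coloring E (D + 1) c"
    by (rule sufficient[of "{}"]) (use D in \<open>auto simp: le_SucI\<close>)
  define Bad where "Bad = {y \<in> P. \<not> M y + f y < D}"
  have f_eq: "f z = card (children z \<inter> Bad)" for z
    unfolding f[rule_format, of z] children_def Bad_def by (rule arg_cong[where f = card]) auto
  have M_eq: "M z \<le> b \<longleftrightarrow> (\<forall>y\<in>children z. degree E y \<le> b + of_bool (y \<in> Bad))" for z b
    unfolding M children_def Bad_def by auto
  \<comment> \<open>A vertex with a parent has fewer than \<open>D\<close> children, so the
    truncated subtraction \<open>D - 1 - f v\<close> below is exact.\<close>
  have fP: "f v < D" if "v \<in> P" for v
  proof -
    have "card (children v \<inter> Bad) \<le> card (children v)" by (rule card_mono) auto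
    then show ?thesis using D[of v] that by (simp add: f_eq degree_eq)
  qed
  have Mf: "M v + f v < D \<longleftrightarrow>
      (\<forall>y\<in>children v. degree E y + card (children v \<inter> Bad) + 1 \<le> D + of_bool (y \<in> Bad))"
    if "v \<in> P" for v
  proof -
    have "M v + f v < D \<longleftrightarrow> M v \<le> D - 1 - f v" using fP[OF that] by auto
    then show ?thesis using fP[OF that] unfolding M_eq f_eq by auto
  qed
  show "(\<exists>c. semistrong_edge_coloring E D c) \<longleftrightarrow> (\<forall>j<n. M j + f j \<le> D \<and> g j + f j \<le> D)"
  proof
    assume "\<exists>c. semistrong_edge_coloring E D c"
    then obtain c where c: "semistrong_edge_coloring E D c" ..
    have tight: "\<exists>y\<in>children v. D + of_bool (y \<in> Bad) < degree E y + card (children v \<inter> Bad) + 1"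
      if "v \<in> Bad" for v
      using that Mf[of v] by (auto simp: Bad_def not_le)
    have Bad_P: "Bad \<subseteq> P" by (auto simp: Bad_def)
    note dn = necessary_down[OF c Bad_P tight] and upw = necessary_up[OF c Bad_P tight]
    show "\<forall>j<n. M j + f j \<le> D \<and> g j + f j \<le> D"
    proof (intro allI impI conjI)
      fix j assume "j < n"
      have "card (children j \<inter> Bad) \<le> card (children j)" by (rule card_mono) auto
      then have fD: "f j \<le> D" using D[of j] by (simp add: f_eq degree_eq)
      have "M j \<le> D - f j" unfolding M_eq
      proof
        fix y assume "y \<in> children j"
        from dn[OF _ this] show "degree E y \<le> D - f j + of_bool (y \<in> Bad)"
          using fD unfolding f_eq by linarith
      qed
      then show "M j + f j \<le> D" using fD by simp
      show "g j + f j \<le> D" using g upw[of j] fD by (auto simp: f_eq)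
    qed
  next
    assume ok: "\<forall>j<n. M j + f j \<le> D \<and> g j + f j \<le> D"
    have par_n: "par y < n" if "y \<in> P" for y
    proof -
      have "{y, par y} \<in> E" using that E by blast
      then show ?thesis using nbrs_subset[OF graph, of y] unfolding nbrs_def by blast
    qed
    show "\<exists>c. semistrong_edge_coloring E D c"
    proof (rule sufficient[of Bad])
      fix v y assume y: "y \<in> children v"
      then have "v < n" using par_n by (auto simp: children_def)
      then have *: "M v \<le> D - f v" "f v \<le> D" using ok[rule_format, of v] by auto
      have "degree E y \<le> D - f v + of_bool (y \<in> Bad)" using *(1) y unfolding M_eq by blast
      then show "degree E y + card (children v \<inter> Bad) \<le> D + of_bool (y \<in> Bad)"
        using *(2) by (simp add: f_eq)
    next
      fix v y assume "v \<in> P" "v \<notin> Bad" "y \<in> children v"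
      then show "degree E y + card (children v \<inter> Bad) + 1 \<le> D + of_bool (y \<in> Bad)"
        using Mf[of v] by (auto simp: Bad_def)
    next
      fix y assume "y \<in> P"
      then show "card (children y \<inter> Bad) + degree E (par y) \<le> D"
        using ok[rule_format, of y] g Pn by (auto simp: f_eq)
    qed (auto simp: Bad_def)
  qed
qed

section \<open>Running times of programs\<close>

text \<open>Loop-free programs act as functions on states, so their runs can be computed by
  rewriting. In the three functions that follow, the values at \<open>While\<close> are mere
  fillers.\<close>

primrec straight :: "com \<Rightarrow> bool" where
  "straight Skip = True"
| "straight (Assign x e) = True"
| "straight (Store a i e) = True"
| "straight (Seq c d) = (straight c \<and> straight d)"
| "straight (Cond b c d) = (straight c \<and> straight d)"
| "straight (While b c) = False"

primrec effect :: "com \<Rightarrow> state \<Rightarrow> state" where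
  "effect Skip s = s"
| "effect (Assign x e) s = s\<lparr>scalar := (scalar s)(x := aval s e)\<rparr>"
| "effect (Store a i e) s = s\<lparr>array := (array s)(a := (array s a)(aval s i := aval s e))\<rparr>"
| "effect (Seq c d) s = effect d (effect c s)"
| "effect (Cond b c d) s = (if bval s b then effect c s else effect d s)"
| "effect (While b c) s = s"

primrec fits :: "nat \<Rightarrow> com \<Rightarrow> state \<Rightarrow> bool" where
  "fits W Skip s = True"
| "fits W (Assign x e) s = (aval s e \<le> W)"
| "fits W (Store a i e) s = (aval s i \<le> W \<and> aval s e \<le> W)"
| "fits W (Seq c d) s = (fits W c s \<and> fits W d (effect c s))"
| "fits W (Cond b c d) s = (if bval s b then fits W c s else fits W d s)"
| "fits W (While b c) s = True"

primrec span :: "com \<Rightarrow> nat" where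
  "span Skip = 1"
| "span (Assign x e) = 1 + acost e"
| "span (Store a i e) = 1 + acost i + acost e"
| "span (Seq c d) = span c + span d"
| "span (Cond b c d) = 1 + bcost b + max (span c) (span d)"
| "span (While b c) = 0"

lemma exec_straight:
  "straight c \<Longrightarrow> fits W c s \<Longrightarrow> \<exists>t \<le> span c. exec W c s t (effect c s)"
proof (induction c arbitrary: s)
  case Skip
  then show ?case using exec.Skip by fastforce
next
  case (Assign x e)
  then show ?case using exec.Assign[of s e W x] by fastforce
next
  case (Store a i e)
  then show ?case using exec.Store[of s i W e a] by fastforce
next
  case (Seq c d)
  then obtain t t' where "t \<le> span c" "exec W c s t (effect c s)"
      "t' \<le> span d" "exec W d (effect c s) t' (effect d (effect c s))"
    by (metis straight.simps(4) fits.simps(4))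
  then show ?case using exec.Seq[of W c s t _ d t'] by (intro exI[of _ "t + t'"]) auto
next
  case (Cond b c d)
  show ?case
  proof (cases "bval s b")
    case True
    then obtain t where "t \<le> span c" "exec W c s t (effect c s)" using Cond by fastforce
    then show ?thesis using exec.CondTrue[OF True] True
      by (intro exI[of _ "1 + bcost b + t"]) auto
  next
    case False
    then obtain t where "t \<le> span d" "exec W d s t (effect d s)" using Cond by fastforce
    then show ?thesis using exec.CondFalse[OF False] False
      by (intro exI[of _ "1 + bcost b + t"]) auto
  qed
qed simp

text \<open>The measure bounds the number of rounds; the one extra round pays for the final failing
  test.\<close>

lemma exec_while:
  assumes body: "straight c"
    and step: "\<And>s. I s \<Longrightarrow> bval s b \<Longrightarrow>
      fits W c s \<and> I (effect c s) \<and> \<mu> (effect c s) < \<mu> s"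
    and "I s"
  shows "\<exists>t s'. exec W (While b c) s t s' \<and>
    t \<le> (\<mu> s + 1) * (1 + bcost b + span c) \<and> I s' \<and> \<not> bval s' b"
  using \<open>I s\<close>
proof (induction "\<mu> s" arbitrary: s rule: less_induct)
  case less
  let ?T = "1 + bcost b + span c"
  show ?case
  proof (cases "bval s b")
    case False
    then show ?thesis using exec.WhileFalse[OF False] less.prems by fastforce
  next
    case True
    note st = step[OF less.prems True]
    then obtain t where t: "t \<le> span c" "exec W c s t (effect c s)"
      using exec_straight[OF body] by blast
    obtain t' s' where t': "exec W (While b c) (effect c s) t' s'"
      "t' \<le> (\<mu> (effect c s) + 1) * ?T" "I s'" "\<not> bval s' b"
      using less.hyps st by blast
    have "(\<mu> (effect c s) + 1) * ?T \<le> \<mu> s * ?T" using st by (intro mult_le_mono1) auto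
    then have "1 + bcost b + t + t' \<le> (\<mu> s + 1) * ?T" using t(1) t'(2) by simp
    then show ?thesis using exec.WhileTrue[OF True t(2) t'(1)] t'(3,4) by blast
  qed
qed

section \<open>The decision procedure\<close>

definition count_body :: com where
  "count_body =
     Seq (Store ''d'' (Arr ''u'' (Var ''i'')) (Add (Arr ''d'' (Arr ''u'' (Var ''i''))) (Const 1)))
    (Seq (Store ''d'' (Arr ''v'' (Var ''i'')) (Add (Arr ''d'' (Arr ''v'' (Var ''i''))) (Const 1)))
    (Seq (Store ''s'' (Arr ''u'' (Var ''i'')) (Add (Arr ''s'' (Arr ''u'' (Var ''i''))) (Arr ''v'' (Var ''i''))))
    (Seq (Store ''s'' (Arr ''v'' (Var ''i'')) (Add (Arr ''s'' (Arr ''v'' (Var ''i''))) (Arr ''u'' (Var ''i''))))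
         (Assign ''i'' (Add (Var ''i'') (Const 1))))))"

text \<open>\<open>r\<close> starts as a copy of \<open>d\<close>, so that the original degrees stay
  available while \<open>r\<close> shrinks.\<close>

definition max_body :: com where
  "max_body =
     Seq (Cond (Less (Var ''D'') (Arr ''d'' (Var ''j''))) (Assign ''D'' (Arr ''d'' (Var ''j''))) Skip)
    (Seq (Store ''r'' (Var ''j'') (Arr ''d'' (Var ''j'')))
         (Assign ''j'' (Add (Var ''j'') (Const 1))))"

text \<open>\<open>w\<close> is what \<open>x\<close> contributes to \<open>M\<close> at its parent:
  its degree, less one if \<open>x\<close> is bad. Afterwards \<open>x\<close> moves to
  \<open>p\<close>, the only vertex that this removal can turn into a leaf.\<close>

definition peel_body :: com where
  "peel_body =
     Cond (Equal (Arr ''r'' (Var ''x'')) (Const 1))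
      (Seq (Assign ''p'' (Arr ''s'' (Var ''x'')))
      (Seq (Cond (Less (Add (Arr ''M'' (Var ''x'')) (Arr ''f'' (Var ''x''))) (Var ''D''))
              (Assign ''w'' (Arr ''d'' (Var ''x'')))
              (Seq (Assign ''w'' (Sub (Arr ''d'' (Var ''x'')) (Const 1)))
                   (Store ''f'' (Var ''p'') (Add (Arr ''f'' (Var ''p'')) (Const 1)))))
      (Seq (Cond (Less (Arr ''M'' (Var ''p'')) (Var ''w'')) (Store ''M'' (Var ''p'') (Var ''w'')) Skip)
      (Seq (Store ''g'' (Var ''x'') (Arr ''d'' (Var ''p'')))
      (Seq (Store ''r'' (Var ''x'') (Const 0))
      (Seq (Store ''r'' (Var ''p'') (Sub (Arr ''r'' (Var ''p'')) (Const 1)))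
      (Seq (Store ''s'' (Var ''p'') (Sub (Arr ''s'' (Var ''p'')) (Var ''x'')))
           (Assign ''x'' (Var ''p'')))))))))
      (Seq (Assign ''x'' (Var ''k''))
           (Assign ''k'' (Add (Var ''k'') (Const 1))))"

definition check_body :: com where
  "check_body =
     Seq (Cond (Less (Var ''D'') (Add (Arr ''M'' (Var ''q'')) (Arr ''f'' (Var ''q''))))
            (Assign ''result'' (Const 0))
            (Cond (Less (Var ''D'') (Add (Arr ''g'' (Var ''q'')) (Arr ''f'' (Var ''q''))))
               (Assign ''result'' (Const 0)) Skip))
         (Assign ''q'' (Add (Var ''q'') (Const 1)))"

definition count_guard :: bexp where "count_guard = Less (Var ''i'') (Var ''m'')"
definition max_guard :: bexp where "max_guard = Less (Var ''j'') (Var ''n'')"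

text \<open>The peeling loop follows a chain of leaves from \<open>x\<close>; when \<open>x\<close> is not a leaf, it restarts at
  the next unscanned vertex \<open>k\<close>.\<close>

definition peel_guard :: bexp where
  "peel_guard = Neg (Conj (Equal (Var ''k'') (Var ''n''))
     (Neg (Equal (Arr ''r'' (Var ''x'')) (Const 1))))"
definition check_guard :: bexp where "check_guard = Less (Var ''q'') (Var ''n'')"

definition decide :: com where
  "decide =
     Seq (While count_guard count_body)
    (Seq (While max_guard max_body)
    (Seq (While peel_guard peel_body)
    (Seq (Assign ''result'' (Const 1))
         (While check_guard check_body))))"

lemma straight_bodies:
  "straight count_body" "straight max_body" "straight peel_body" "straight check_body"
  by (simp_all add: count_body_def max_body_def peel_body_def check_body_def)

section \<open>Loop invariants\<close>

definition listed :: "(nat \<times> nat) list \<Rightarrow> nat \<Rightarrow> nat set set" where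
  "listed es i = set (map (\<lambda>(u, v). {u, v}) (take i es))"

definition count_inv :: "nat \<Rightarrow> (nat \<times> nat) list \<Rightarrow> state \<Rightarrow> bool" where
  "count_inv n es s \<longleftrightarrow>
     scalar s ''n'' = n \<and> scalar s ''m'' = length es \<and> scalar s ''i'' \<le> length es \<and>
     scalar s ''j'' = 0 \<and> scalar s ''k'' = 0 \<and> scalar s ''x'' = 0 \<and> scalar s ''q'' = 0 \<and>
     scalar s ''D'' = 0 \<and>
     (\<forall>i<length es. array s ''u'' i = fst (es ! i) \<and> array s ''v'' i = snd (es ! i)) \<and>
     array s ''d'' = (\<lambda>z. card (nbrs (listed es (scalar s ''i'')) z)) \<and>
     array s ''s'' = (\<lambda>z. \<Sum>(nbrs (listed es (scalar s ''i'')) z)) \<and>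
     array s ''r'' = (\<lambda>_. 0) \<and> array s ''f'' = (\<lambda>_. 0) \<and> array s ''M'' = (\<lambda>_. 0) \<and>
     array s ''g'' = (\<lambda>_. 0)"

definition max_inv :: "nat \<Rightarrow> nat set set \<Rightarrow> state \<Rightarrow> bool" where
  "max_inv n E s \<longleftrightarrow>
     scalar s ''n'' = n \<and> scalar s ''j'' \<le> n \<and>
     scalar s ''k'' = 0 \<and> scalar s ''x'' = 0 \<and> scalar s ''q'' = 0 \<and>
     (\<forall>b. scalar s ''D'' \<le> b \<longleftrightarrow> (\<forall>z<scalar s ''j''. degree E z \<le> b)) \<and>
     array s ''d'' = degree E \<and> array s ''s'' = (\<lambda>z. \<Sum>(nbrs E z)) \<and>
     array s ''r'' = (\<lambda>z. if z < scalar s ''j'' then degree E z else 0) \<and>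
     array s ''f'' = (\<lambda>_. 0) \<and> array s ''M'' = (\<lambda>_. 0) \<and> array s ''g'' = (\<lambda>_. 0)"

text \<open>Among the vertices scanned so far only the current \<open>x\<close> may be a leaf, so
  none is left when the guard fails.\<close>

definition peel_inv :: "nat \<Rightarrow> nat set set \<Rightarrow> nat \<Rightarrow> state \<Rightarrow> bool" where
  "peel_inv n E D s \<longleftrightarrow>
     scalar s ''n'' = n \<and> scalar s ''D'' = D \<and> scalar s ''q'' = 0 \<and>
     scalar s ''k'' \<le> n \<and> scalar s ''x'' < n \<and> array s ''d'' = degree E \<and>
     (\<forall>z<scalar s ''k''. z \<noteq> scalar s ''x'' \<longrightarrow> array s ''r'' z \<noteq> 1) \<and>
     (\<exists>P par rk F. peeled n E D P par rk F (array s ''r'') (array s ''s'') (array s ''f'')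
        (array s ''M'') (array s ''g''))"

definition check_inv :: "nat \<Rightarrow> nat \<Rightarrow> (nat \<Rightarrow> nat) \<Rightarrow> (nat \<Rightarrow> nat) \<Rightarrow> (nat \<Rightarrow> nat) \<Rightarrow> state \<Rightarrow> bool" where
  "check_inv n D f M g s \<longleftrightarrow>
     scalar s ''n'' = n \<and> scalar s ''D'' = D \<and> scalar s ''q'' \<le> n \<and>
     array s ''f'' = f \<and> array s ''M'' = M \<and> array s ''g'' = g \<and>
     scalar s ''result'' = of_bool (\<forall>j<scalar s ''q''. M j + f j \<le> D \<and> g j + f j \<le> D)"

lemma nbrs_insert_edge:
  assumes "a \<noteq> b"
  shows "nbrs (insert {a, b} F) z =
    (if z = a then insert b (nbrs F z) else if z = b then insert a (nbrs F z) else nbrs F z)"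
  using assms by (auto simp: nbrs_def doubleton_eq_iff)

lemma card_nbrs_le: "simple_graph {..<n} F \<Longrightarrow> card (nbrs F z) \<le> n"
  using card_mono[of "{..<n}" "nbrs F z"] nbrs_subset[of "{..<n}" F z] by auto

text \<open>The array \<open>s\<close> holds such sums, which is why the largest word is taken
  quadratic in \<open>n\<close>.\<close>

lemma sum_nbrs_le:
  fixes n :: nat
  assumes "simple_graph {..<n} F"
  shows "\<Sum>(nbrs F z) \<le> n * n"
proof -
  have "\<Sum>(nbrs F z) \<le> of_nat (card (nbrs F z)) * n"
    by (rule sum_bounded_above) (use nbrs_subset[OF assms, of z] in auto)
  also have "\<dots> \<le> n * n" using card_nbrs_le[OF assms] by simp
  finally show ?thesis .
qed

lemma card_edges_le:
  assumes "simple_graph {..<n} E"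
  shows "card E \<le> n * n"
proof -
  have "E \<subseteq> (\<lambda>(u, v). {u, v}) ` ({..<n} \<times> {..<n})"
    using assms unfolding simple_graph_def by auto
  then have "card E \<le> card ({..<n} \<times> {..<n})" by (rule surj_card_le[rotated]) simp
  then show ?thesis by simp
qed

section \<open>Preservation of the invariants and word bounds\<close>

context
  fixes n :: nat and E :: "nat set set" and W :: nat
  assumes graph: "simple_graph {..<n} E" and W: "n * n + n + 1 \<le> W"
begin

lemma count_step:
  assumes el: "edge_list E es" and inv: "count_inv n es s" and b: "bval s count_guard"
  shows "fits W count_body s \<and> count_inv n es (effect count_body s) \<and>
    length es - scalar (effect count_body s) ''i'' < length es - scalar s ''i''"
proof -
  define i where "i = scalar s ''i''"
  have i: "i < length es" using inv b by (simp add: count_inv_def count_guard_def i_def)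
  obtain a c where ac: "es ! i = (a, c)" by fastforce
  have arr: "array s ''u'' i = a" "array s ''v'' i = c"
    using inv i ac by (auto simp: count_inv_def)
  define F where "F = listed es i"
  have F': "listed es (Suc i) = insert {a, c} F"
    using i ac by (simp add: listed_def F_def take_Suc_conv_app_nth)
  have sub: "listed es j \<subseteq> E" for j
    using el set_take_subset[of j es] unfolding edge_list_def listed_def by auto
  \<comment> \<open>Each edge is listed once, so it is new to the prefix and raises both degrees by
    exactly one.\<close>
  have new: "{a, c} \<notin> F"
  proof -
    have "distinct (map (\<lambda>(u, v). {u, v}) (take (Suc i) es))"
      using el unfolding edge_list_def by (simp add: take_map[symmetric])
    then show ?thesis using i ac by (simp add: take_Suc_conv_app_nth F_def listed_def)
  qed
  have gF: "simple_graph {..<n} F" "simple_graph {..<n} (insert {a, c} F)"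
    using simple_graph_mono[OF graph sub] F' unfolding F_def by metis+
  have acn: "a \<noteq> c" "a < n" "c < n"
    using gF(2) unfolding simple_graph_def by (auto simp: doubleton_eq_iff)
  have notin: "c \<notin> nbrs F a" "a \<notin> nbrs F c" using new by (auto simp: nbrs_def insert_commute)
  have fin: "finite (nbrs F z)" for z using finite_nbrs[OF gF(1)] .
  have d: "array s ''d'' = (\<lambda>z. card (nbrs F z))" and ss: "array s ''s'' = (\<lambda>z. \<Sum>(nbrs F z))"
    using inv by (simp_all add: count_inv_def F_def i_def)
  note nb = nbrs_insert_edge[OF acn(1), of F]
  have cards: "card (nbrs F a) + 1 \<le> n" "card (nbrs F c) + 1 \<le> n"
    using card_nbrs_le[OF gF(2), of a] card_nbrs_le[OF gF(2), of c] acn notin fin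
    by (auto simp: nb)
  have sums: "\<Sum>(nbrs F a) + c \<le> n * n" "\<Sum>(nbrs F c) + a \<le> n * n"
    using sum_nbrs_le[OF gF(2), of a] sum_nbrs_le[OF gF(2), of c] acn notin fin
    by (auto simp: nb)
  have iW: "Suc i \<le> W"
  proof -
    have "length es = card E" using el distinct_card unfolding edge_list_def by fastforce
    also have "\<dots> \<le> n * n" by (rule card_edges_le[OF graph])
    finally show ?thesis using i W by simp
  qed
  have "fits W count_body s"
    using cards sums acn W iW
    by (simp add: count_body_def d ss arr i_def[symmetric])
  moreover have "count_inv n es (effect count_body s)"
    using inv i acn notin fin unfolding count_inv_def
    by (auto simp: count_body_def d ss arr i_def[symmetric] F' nb fun_eq_iff)
  moreover have "scalar (effect count_body s) ''i'' = Suc i"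
    by (simp add: count_body_def i_def)
  ultimately show ?thesis using i by (simp add: i_def)
qed

lemma degree_le: "degree E z \<le> n"
  using card_nbrs_le[OF graph] degree_eq_card_nbrs[OF graph] by simp

lemma max_step:
  assumes inv: "max_inv n E s" and b: "bval s max_guard"
  shows "fits W max_body s \<and> max_inv n E (effect max_body s) \<and>
    n - scalar (effect max_body s) ''j'' < n - scalar s ''j''"
proof -
  define j where "j = scalar s ''j''"
  have j: "j < n" using inv b by (simp add: max_inv_def max_guard_def j_def)
  have d: "array s ''d'' = degree E"
    and Db: "\<forall>b. scalar s ''D'' \<le> b \<longleftrightarrow> (\<forall>z<j. degree E z \<le> b)"
    using inv by (simp_all add: max_inv_def j_def)
  have Db': "(\<forall>z<Suc j. degree E z \<le> b) \<longleftrightarrow> max (scalar s ''D'') (degree E j) \<le> b" for b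
    using Db by (auto simp: less_Suc_eq)
  have "fits W max_body s"
    using W degree_le[of j] j by (simp add: max_body_def d j_def[symmetric])
  moreover have "max_inv n E (effect max_body s)"
    using inv j unfolding max_inv_def
    by (simp add: max_body_def d j_def[symmetric] Db') (auto simp: fun_eq_iff less_Suc_eq)
  moreover have "scalar (effect max_body s) ''j'' = Suc j"
    by (simp add: max_body_def j_def)
  ultimately show ?thesis using j by (simp add: j_def)
qed

text \<open>The potential counts unscanned vertices and vertices with remaining edges: removing a
  leaf sets its \<open>r\<close> to 0, and otherwise \<open>k\<close> advances. It is at most
  \<open>2 * n\<close>, hence linearly many rounds.\<close>

lemma peel_step:
  assumes inv: "peel_inv n E D s" and b: "bval s peel_guard"
  shows "fits W peel_body s \<and> peel_inv n E D (effect peel_body s) \<and>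
    n - scalar (effect peel_body s) ''k'' + card {z. z < n \<and> array (effect peel_body s) ''r'' z \<noteq> 0}
      < n - scalar s ''k'' + card {z. z < n \<and> array s ''r'' z \<noteq> 0}"
proof -
  define x where "x = scalar s ''x''"
  define k where "k = scalar s ''k''"
  define r where "r = array s ''r''"
  define ss where "ss = array s ''s''"
  define f where "f = array s ''f''"
  define M where "M = array s ''M''"
  define g where "g = array s ''g''"
  note defs = x_def[symmetric] k_def[symmetric] r_def[symmetric] ss_def[symmetric]
    f_def[symmetric] M_def[symmetric] g_def[symmetric]
  obtain P par rk F where pe: "peeled n E D P par rk F r ss f M g"
    using inv unfolding peel_inv_def defs by blast
  have sc: "scalar s ''n'' = n" "scalar s ''D'' = D" "scalar s ''q'' = 0" "k \<le> n" "x < n"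
    "array s ''d'' = degree E" and rk1: "\<forall>z<k. z \<noteq> x \<longrightarrow> r z \<noteq> 1"
    using inv unfolding peel_inv_def defs by blast+
  let ?e = "effect peel_body s"
  show ?thesis
  proof (cases "r x = 1")
    case True
    define p where "p = ss x"
    note lf = leaf_facts[OF graph pe True p_def] and st = peeled_step[OF graph pe True p_def]
    have er: "array ?e ''r'' = r(x := 0, p := r p - 1)"
      using True lf(5) by (simp add: peel_body_def defs p_def[symmetric])
    have es: "array ?e ''s'' = ss(p := ss p - x)"
      using True by (simp add: peel_body_def defs p_def[symmetric])
    have ef: "array ?e ''f'' = f(p := f p + of_bool (\<not> M x + f x < D))"
      using True by (simp add: peel_body_def defs p_def[symmetric] sc)
    have eM: "array ?e ''M'' = M(p := max (M p) (degree E x - of_bool (\<not> M x + f x < D)))"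
      using True by (auto simp: peel_body_def defs p_def[symmetric] sc fun_eq_iff)
    have eg: "array ?e ''g'' = g(x := degree E p)"
      using True by (simp add: peel_body_def defs p_def[symmetric] sc)
    have esc: "scalar ?e ''n'' = n" "scalar ?e ''D'' = D" "scalar ?e ''q'' = 0"
      "scalar ?e ''k'' = k" "scalar ?e ''x'' = p" "array ?e ''d'' = degree E"
      using True by (simp_all add: peel_body_def defs p_def[symmetric] sc)
    have "peel_inv n E D ?e"
      unfolding peel_inv_def er es ef eM eg esc
    proof (intro conjI)
      show "\<forall>z<k. z \<noteq> p \<longrightarrow> (r(x := 0, p := r p - 1)) z \<noteq> 1" using rk1 by auto
    qed (use sc(4) lf(7) st in blast)+
    moreover have "card {z. z < n \<and> array ?e ''r'' z \<noteq> 0} < card {z. z < n \<and> r z \<noteq> 0}"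
    proof (rule psubset_card_mono)
      have "x \<in> {z. z < n \<and> r z \<noteq> 0}" using sc(5) True by simp
      moreover have "x \<notin> {z. z < n \<and> array ?e ''r'' z \<noteq> 0}" using lf(5) by (simp add: er)
      moreover have "{z. z < n \<and> array ?e ''r'' z \<noteq> 0} \<subseteq> {z. z < n \<and> r z \<noteq> 0}"
        by (auto simp: er split: if_splits)
      ultimately show "{z. z < n \<and> array ?e ''r'' z \<noteq> 0} \<subset> {z. z < n \<and> r z \<noteq> 0}" by blast
    qed simp
    moreover have "fits W peel_body s"
    proof -
      have FE: "F \<subseteq> E" and Pn: "P \<subseteq> {..<n}" and rc: "r p = card (nbrs F p)"
        and sp: "ss p = \<Sum>(nbrs F p)"
        using pe lf(4) unfolding peeled_def by blast+
      have gF: "simple_graph {..<n} F" using simple_graph_mono[OF graph FE] .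
      \<comment> \<open>\<open>f\<close> counts removed children, of which there are at most
        \<open>n\<close>.\<close>
      have "f p + of_bool (\<not> M x + f x < D) \<le> card (insert x P)"
      proof -
        have "(f(p := f p + of_bool (\<not> M x + f x < D))) p \<le> card (insert x P)"
          using st unfolding peeled_def
          by (metis (no_types, lifting) Pn card_mono finite_insert finite_lessThan finite_subset
              mem_Collect_eq subsetI)
        then show ?thesis by simp
      qed
      also have "\<dots> \<le> n" using Pn lf(6) card_mono[of "{..<n}" "insert x P"] by simp
      finally have fp: "f p + of_bool (\<not> M x + f x < D) \<le> n" .
      show ?thesis
        using True fp degree_le[of x] degree_le[of p] card_nbrs_le[OF gF, of p]
          sum_nbrs_le[OF gF, of p] W lf(5,6,7)
        by (auto simp: peel_body_def defs p_def[symmetric] sc(1-3,6) rc sp)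
    qed
    ultimately show ?thesis using esc(4) unfolding defs by simp
  next
    case False
    then have k: "k < n" using b sc by (auto simp: peel_guard_def defs)
    have arr: "array ?e = array s" using False by (simp add: peel_body_def defs)
    have esc: "scalar ?e ''n'' = n" "scalar ?e ''D'' = D" "scalar ?e ''q'' = 0"
      "scalar ?e ''k'' = Suc k" "scalar ?e ''x'' = k"
      using False by (simp_all add: peel_body_def defs sc)
    have "fits W peel_body s" using False k W by (simp add: peel_body_def defs)
    moreover have "peel_inv n E D ?e"
      unfolding peel_inv_def esc arr defs sc
    proof (intro conjI)
      show "\<forall>z<Suc k. z \<noteq> k \<longrightarrow> r z \<noteq> 1" using rk1 False by (auto simp: less_Suc_eq)
    qed (use k pe in auto)
    ultimately show ?thesis using k by (simp add: esc arr defs)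
  qed
qed

lemma check_step:
  assumes inv: "check_inv n D f M g s" and b: "bval s check_guard"
  shows "fits W check_body s \<and> check_inv n D f M g (effect check_body s) \<and>
    n - scalar (effect check_body s) ''q'' < n - scalar s ''q''"
proof -
  define q where "q = scalar s ''q''"
  have q: "q < n" using inv b by (simp add: check_inv_def check_guard_def q_def)
  have "fits W check_body s"
    using W q by (simp add: check_body_def q_def[symmetric])
  moreover have "check_inv n D f M g (effect check_body s)"
    using inv q unfolding check_inv_def
    by (auto simp: check_body_def q_def[symmetric] less_Suc_eq)
  moreover have "scalar (effect check_body s) ''q'' = Suc q"
    by (simp add: check_body_def q_def)
  ultimately show ?thesis using q by (simp add: q_def)
qed

end

section \<open>Chaining the loops and the total running time\<close>

lemma count_inv_initial: "count_inv n es (input_state n es)"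
  by (simp add: count_inv_def input_state_def listed_def nbrs_def)

lemma max_inv_initial:
  assumes graph: "simple_graph {..<n} E" and el: "edge_list E es"
    and inv: "count_inv n es s" and stop: "\<not> bval s count_guard"
  shows "max_inv n E s" "scalar s ''j'' = 0"
proof -
  have "scalar s ''i'' = length es" using inv stop by (simp add: count_inv_def count_guard_def)
  moreover have "listed es (length es) = E" using el by (simp add: listed_def edge_list_def)
  ultimately show "max_inv n E s" "scalar s ''j'' = 0"
    using inv degree_eq_card_nbrs[OF graph]
    by (simp_all add: max_inv_def count_inv_def fun_eq_iff)
qed

lemma peel_inv_initial:
  assumes graph: "simple_graph {..<n} E" and n: "n \<ge> 1"
    and inv: "max_inv n E s" and stop: "\<not> bval s max_guard"
  shows "peel_inv n E (max_degree {..<n} E) s"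
proof -
  have j: "scalar s ''j'' = n" using inv stop by (simp add: max_inv_def max_guard_def)
  \<comment> \<open>Numbers from \<open>n\<close> on have no neighbours, so the untouched zero
    entries of \<open>r\<close> are correct there.\<close>
  have "nbrs E z = {}" if "\<not> z < n" for z
    using graph that unfolding simple_graph_def nbrs_def by (auto simp: doubleton_eq_iff)
  then have r: "array s ''r'' = (\<lambda>z. card (nbrs E z))"
    using inv by (auto simp: max_inv_def j degree_eq_card_nbrs[OF graph])
  have D: "scalar s ''D'' \<le> b \<longleftrightarrow> (\<forall>z<n. degree E z \<le> b)" for b
    using inv by (simp add: max_inv_def j)
  have "scalar s ''D'' = max_degree {..<n} E"
  proof (rule antisym)
    show "scalar s ''D'' \<le> max_degree {..<n} E" by (simp add: D max_degree_def)
    have "\<forall>z<n. degree E z \<le> scalar s ''D''" using D by blast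
    moreover have "0 \<in> {..<n}" using n by simp
    then have "{..<n} \<noteq> {}" by blast
    ultimately show "max_degree {..<n} E \<le> scalar s ''D''" by (simp add: max_degree_def)
  qed
  moreover have "peeled n E D {} (\<lambda>_. 0) (\<lambda>_. n) E (array s ''r'') (array s ''s'') (array s ''f'')
      (array s ''M'') (array s ''g'')" for D
    using inv peeled_initial[of n E D "\<lambda>_. 0"] by (simp add: max_inv_def r)
  then have "\<exists>P par rk F. peeled n E D P par rk F (array s ''r'') (array s ''s'') (array s ''f'')
      (array s ''M'') (array s ''g'')" for D
    by blast
  ultimately show ?thesis using inv n unfolding peel_inv_def
    by (simp add: max_inv_def)
qed

lemma degree_le_max_degree:
  fixes n :: nat
  assumes graph: "simple_graph {..<n} E"
  shows "degree E v \<le> max_degree {..<n} E"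
proof (cases "v < n")
  case True
  then show ?thesis by (simp add: max_degree_def)
next
  case False
  then have "nbrs E v = {}"
    using graph unfolding simple_graph_def nbrs_def by (auto simp: doubleton_eq_iff)
  then show ?thesis by (simp add: degree_eq_card_nbrs[OF graph])
qed

text \<open>A walk from 0 to 1 has to leave 0 along an edge.\<close>

lemma max_degree_pos:
  fixes n :: nat
  assumes "tree {..<n} E" "n \<ge> 2"
  shows "max_degree {..<n} E \<ge> 1"
proof -
  have graph: "simple_graph {..<n} E" and conn: "connected_graph {..<n} E"
    using assms(1) by (auto simp: tree_def)
  obtain p where p: "walk {..<n} E p" "hd p = 0" "last p = 1"
    using conn assms(2) unfolding connected_graph_def
    by (metis Suc_1 Suc_le_eq lessThan_iff less_trans zero_less_one)
  then obtain a q where "p = 0 # a # q"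
    unfolding walk_def by (metis last_ConsL list.exhaust_sel zero_neq_one)
  then have "a \<in> nbrs E 0" using p(1) by (simp add: walk_def nbrs_def)
  then have "degree E 0 \<ge> 1"
    using finite_nbrs[OF graph, of 0]
    by (metis card_0_eq degree_eq_card_nbrs[OF graph] empty_iff less_one linorder_not_less)
  then show ?thesis using degree_le_max_degree[OF graph, of 0] by simp
qed

definition loop_cost :: "bexp \<Rightarrow> com \<Rightarrow> nat" where
  "loop_cost b c = 1 + bcost b + span c"

text \<open>For \<open>n \<ge> 1\<close>, a loop with at most \<open>n\<close> rounds is charged for
  \<open>n + 1 \<le> 2 * n\<close>, and the peeling loop for \<open>2 * n + 1 \<le> 3 * n\<close>.
  The final 2 covers the assignment to \<open>result\<close>.\<close>

definition time_factor :: nat where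
  "time_factor = 2 * loop_cost count_guard count_body + 2 * loop_cost max_guard max_body +
     3 * loop_cost peel_guard peel_body + 2 * loop_cost check_guard check_body + 2"

lemma decide_correct:
  assumes tree: "tree {..<n} E" and el: "edge_list E es"
  defines "D \<equiv> max_degree {..<n} E"
  shows "\<exists>t s. exec ((n + 2) ^ 2) decide (input_state n es) t s \<and> t \<le> time_factor * n \<and>
    scalar s ''result'' = of_bool (\<exists>c. semistrong_edge_coloring E D c) \<and>
    (\<exists>c. semistrong_edge_coloring E (D + 1) c)"
proof -
  let ?W = "(n + 2) ^ 2"
  have graph: "simple_graph {..<n} E" and acyclic: "\<nexists>p. cycle {..<n} E p" and n: "n \<ge> 1"
    using tree by (auto simp: tree_def connected_graph_def)
  have W: "n * n + n + 1 \<le> ?W" by (simp add: power2_eq_square algebra_simps)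

  obtain t1 s1 where 1: "exec ?W (While count_guard count_body) (input_state n es) t1 s1"
    "t1 \<le> (length es - scalar (input_state n es) ''i'' + 1) * loop_cost count_guard count_body"
    "count_inv n es s1" "\<not> bval s1 count_guard"
    using exec_while[OF straight_bodies(1), of "count_inv n es" count_guard ?W
        "\<lambda>s. length es - scalar s ''i''", OF count_step[OF graph W el] count_inv_initial]
    unfolding loop_cost_def by blast
  note init2 = max_inv_initial[OF graph el 1(3,4)]
  obtain t2 s2 where 2: "exec ?W (While max_guard max_body) s1 t2 s2"
    "t2 \<le> (n - scalar s1 ''j'' + 1) * loop_cost max_guard max_body"
    "max_inv n E s2" "\<not> bval s2 max_guard"
    using exec_while[OF straight_bodies(2), of "max_inv n E" max_guard ?W
        "\<lambda>s. n - scalar s ''j''", OF max_step[OF graph W] init2(1)]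
    unfolding loop_cost_def by blast
  note init3 = peel_inv_initial[OF graph n 2(3,4), folded D_def]
  obtain t3 s3 where 3: "exec ?W (While peel_guard peel_body) s2 t3 s3"
    "t3 \<le> (n - scalar s2 ''k'' + card {z. z < n \<and> array s2 ''r'' z \<noteq> 0} + 1)
       * loop_cost peel_guard peel_body"
    "peel_inv n E D s3" "\<not> bval s3 peel_guard"
    using exec_while[OF straight_bodies(3), of "peel_inv n E D" peel_guard ?W
        "\<lambda>s. n - scalar s ''k'' + card {z. z < n \<and> array s ''r'' z \<noteq> 0}",
        OF peel_step[OF graph W] init3]
    unfolding loop_cost_def by blast
  obtain P par rk F where pe: "peeled n E D P par rk F (array s3 ''r'') (array s3 ''s'')
      (array s3 ''f'') (array s3 ''M'') (array s3 ''g'')"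
    using 3(3) unfolding peel_inv_def by blast
  have "\<forall>j<n. array s3 ''r'' j \<noteq> 1"
    using 3(3,4) by (auto simp: peel_inv_def peel_guard_def)
  then have "F = {}" by (rule peeled_complete[OF graph acyclic pe])
  note correct = peeled_correct[OF graph pe[unfolded this]
      degree_le_max_degree[OF graph, folded D_def]]
  let ?s3 = "s3\<lparr>scalar := (scalar s3)(''result'' := 1)\<rparr>"
  have init4: "check_inv n D (array s3 ''f'') (array s3 ''M'') (array s3 ''g'') ?s3"
    using 3(3) by (simp add: check_inv_def peel_inv_def)
  obtain t4 s4 where 4: "exec ?W (While check_guard check_body) ?s3 t4 s4"
    "t4 \<le> (n - scalar ?s3 ''q'' + 1) * loop_cost check_guard check_body"
    "check_inv n D (array s3 ''f'') (array s3 ''M'') (array s3 ''g'') s4" "\<not> bval s4 check_guard"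
    using exec_while[OF straight_bodies(4),
        of "check_inv n D (array s3 ''f'') (array s3 ''M'') (array s3 ''g'')" check_guard ?W
        "\<lambda>s. n - scalar s ''q''", OF check_step[OF graph W] init4]
    unfolding loop_cost_def by blast
  have "exec ?W (Assign ''result'' (Const 1)) s3 (1 + acost (Const 1)) ?s3"
    by (rule exec.Assign[of s3 "Const 1" ?W "''result''", unfolded aval.simps]) (use W in linarith)
  then have exec: "exec ?W decide (input_state n es) (t1 + (t2 + (t3 + (1 + acost (Const 1) + t4)))) s4"
    unfolding decide_def using 1(1) 2(1) 3(1) 4(1) by (intro exec.Seq)
  have "length es = card E" using el distinct_card unfolding edge_list_def by fastforce
  \<comment> \<open>The bound is a by-product of peeling: each edge has its own removed lower
    end.\<close>
  then have m: "length es \<le> n" using correct(3) by simp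
  have "t1 \<le> (2 * n) * loop_cost count_guard count_body"
    by (rule order_trans[OF 1(2) mult_le_mono1]) (use m n in simp)
  moreover have "t2 \<le> (2 * n) * loop_cost max_guard max_body"
    by (rule order_trans[OF 2(2) mult_le_mono1]) (use n in simp)
  moreover have "card {z. z < n \<and> array s2 ''r'' z \<noteq> 0} \<le> n"
    using card_mono[of "{..<n}" "{z. z < n \<and> array s2 ''r'' z \<noteq> 0}"] by auto
  then have "t3 \<le> (3 * n) * loop_cost peel_guard peel_body"
    by (intro order_trans[OF 3(2) mult_le_mono1]) (use n in simp)
  moreover have "t4 \<le> (2 * n) * loop_cost check_guard check_body"
    by (rule order_trans[OF 4(2) mult_le_mono1]) (use n in simp)
  ultimately have "t1 + (t2 + (t3 + (1 + acost (Const 1) + t4))) \<le> time_factor * n"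
    using n unfolding time_factor_def by (simp add: algebra_simps)
  moreover have "scalar s4 ''result'' = of_bool (\<exists>c. semistrong_edge_coloring E D c)"
    using 4(3,4) correct(1) by (auto simp: check_inv_def check_guard_def)
  ultimately show ?thesis using exec correct(2) by blast
qed

theorem theorem2:
  shows "\<exists>(P :: com) (C :: nat) (k :: nat).
    \<forall>(n :: nat) (E :: nat set set) (es :: (nat \<times> nat) list).
      tree {..<n} E \<and> edge_list E es \<longrightarrow>
      (\<exists>t s. exec ((n + 2) ^ k) P (input_state n es) t s \<and>
         t \<le> C * max 1 (max_degree {..<n} E ^ 6 * n) \<and>
         (scalar s ''result'' = 1 \<and>
            semistrong_chromatic_index E = max_degree {..<n} E \<and>
            (\<exists>c. semistrong_edge_coloring E (max_degree {..<n} E) c)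
          \<or>
          scalar s ''result'' = 0 \<and>
            semistrong_chromatic_index E = max_degree {..<n} E + 1 \<and>
            (\<nexists>c. semistrong_edge_coloring E (max_degree {..<n} E) c)))"
proof (rule exI[of _ decide], rule exI[of _ time_factor], rule exI[of _ 2], intro allI impI, elim conjE)
  fix n :: nat and E :: "nat set set" and es :: "(nat \<times> nat) list"
  assume tree: "tree {..<n} E" and el: "edge_list E es"
  let ?D = "max_degree {..<n} E"
  have graph: "simple_graph {..<n} E" and ne: "{..<n} \<noteq> {}"
    using tree by (auto simp: tree_def connected_graph_def)
  obtain t s where run: "exec ((n + 2) ^ 2) decide (input_state n es) t s" "t \<le> time_factor * n"
    "scalar s ''result'' = of_bool (\<exists>c. semistrong_edge_coloring E ?D c)"
    and succ: "\<exists>c. semistrong_edge_coloring E (?D + 1) c"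
    using decide_correct[OF tree el] by blast
  \<comment> \<open>For \<open>n = 1\<close> the product is 0, and the maximum with 1 takes over.
    From \<open>n = 2\<close> on the maximum degree is positive, so the linear bound
    suffices.\<close>
  have "n \<le> max 1 (?D ^ 6 * n)"
  proof (cases "n \<ge> 2")
    case True
    then have "1 \<le> ?D ^ 6" using max_degree_pos[OF tree] by simp
    then show ?thesis by (simp add: le_max_iff_disj)
  qed auto
  then have time: "t \<le> time_factor * max 1 (?D ^ 6 * n)"
    using run(2) by (meson mult_le_mono2 order_trans)
  have lower: "?D \<le> k" if "\<exists>c. semistrong_edge_coloring E k c" for k
    using that max_degree_le_if_semistrong[OF graph _ ne] by blast
  show "\<exists>t s. exec ((n + 2) ^ 2) decide (input_state n es) t s \<and>
         t \<le> time_factor * max 1 (?D ^ 6 * n) \<and>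
         (scalar s ''result'' = 1 \<and>
            semistrong_chromatic_index E = ?D \<and> (\<exists>c. semistrong_edge_coloring E ?D c)
          \<or>
          scalar s ''result'' = 0 \<and>
            semistrong_chromatic_index E = ?D + 1 \<and> (\<nexists>c. semistrong_edge_coloring E ?D c))"
  proof (cases "\<exists>c. semistrong_edge_coloring E ?D c")
    case True
    then have "semistrong_chromatic_index E = ?D"
      unfolding semistrong_chromatic_index_def by (intro Least_equality) (use lower in auto)
    then show ?thesis using run(1,3) time True by auto
  next
    case False
    have "?D + 1 \<le> k" if "\<exists>c. semistrong_edge_coloring E k c" for k
      using lower[OF that] that False by (metis Suc_eq_plus1 le_neq_implies_less Suc_leI)
    then have "semistrong_chromatic_index E = ?D + 1"
      unfolding semistrong_chromatic_index_def by (intro Least_equality) (use succ in auto)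
    then show ?thesis using run(1,3) time False by auto
  qed
qed

end
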